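(* There exist $C>1$, $\nu_0>0$ and numbers $Q_n>0$ ($n\ge 0$) satisfying $$C^{-1}\le Q_{n+1}/Q_n\le C,$$ such that, with $N_1(\nu)=C^{-1}\big(\nu\log\frac1\nu\big)^{-1/3}$, $$C^{-1}\le\frac{\widetilde{\mathcal{L}}_\nu^{\,n}(\mathbf{1})(x)}{Q_n}\le C\chi_\nu(x)\qquad\text{for all } x\in\mathbb{R}^d,\ 0\le n\le N_1(\nu),\ 0<\nu\le\nu_0 .$$
   Context: $C_{\mathrm{per}}(\mathbb{R}^d)$ denotes $\mathbb{Z}^d$-periodic continuous functions, $C^3_{\mathrm{per}}$ the $C^3$ ones. Standing assumption: $F\in C^3_{\mathrm{per}}(\mathbb{R}^d)$, $F(0)=0$, $F$ attains its minimum over $\mathbb{T}^d=\mathbb{R}^d/\mathbb{Z}^d$ exactly at $0$, and $D^2F(0)$ is strictly positive definite. $h(y,x)=\frac12|x-y|^2+F(y)$. $\psi\in C_{\mathrm{per}}(\mathbb{R}^d)$ is the unique function with $\psi(0)=0$ and $\psi(x)=\min_{y\in\mathbb{R}^d}\{\psi(y)+h(y,x)\}$ for all $x$. $h_\psi(y,x)=\psi(y)+h(y,x)$ and $\tilde h(y,x)=h(y,x)+\psi(y)-\psi(x)$. For each $x$ at which $\psi$ is differentiable, $h_\psi(\cdot,x)$ has a unique minimizer, denoted $\bar y(x)$. $\mathcal{D}^-(\psi)=\bigcup_{x\in\mathbb{R}^d}\operatorname{argmin}h_\psi(\cdot,x)$; $\psi$ is differentiable on this set. $U\supset\mathcal{D}^-(\psi)$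 is a fixed $\mathbb{Z}^d$-periodic open set for which (with some $\delta>0$ depending only on $F$): $\psi$ is $C^3$ on $U$ with uniformly bounded second derivatives; $h_\psi(y,x)-h_\psi(\bar y(x),x)\ge\delta|y-\bar y(x)|^2$ for all $x\in U$, $y\in\mathbb{R}^d$; and $h_\psi(y,x)-\min h_\psi(\cdot,x)\ge\delta$ for all $x\in\mathbb{R}^d$, $y\notin U$. (Such $U$ exists.) $\chi_\nu(x)=1$ for $x\in U$ and $\chi_\nu(x)=\nu^{-d/2}$ for $x\notin U$. $\widetilde K_\nu(y,x)=(4\pi\nu)^{-d/2}\exp\big(-\frac1{2\nu}\tilde h(y,x)\big)$, $\widetilde{\mathcal{L}}_\nu(u)(x)=\int_{\mathbb{R}^d}\widetilde K_\nu(y,x)u(y)\,dy$, and $\mathbf{1}$ is the constant function $1$. *)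

theory Defs
  imports "HOL-Analysis.Analysis"
begin

section \<open>Periodic functions and smoothness\<close>

text \<open>The ambient space \<open>\<real>\<^sup>d\<close> is \<^typ>\<open>real ^ 'd\<close> with \<open>d = CARD('d)\<close>.\<close>

definition int_lattice :: "(real ^ 'd) set" where
  "int_lattice = {k. \<forall>i. k $ i \<in> \<int>}"

definition periodic :: "(real ^ 'd \<Rightarrow> 'b) \<Rightarrow> bool" where
  "periodic f \<longleftrightarrow> (\<forall>x. \<forall>k\<in>int_lattice. f (x + k) = f x)"

definition partial_deriv :: "'d \<Rightarrow> (real ^ 'd::finite \<Rightarrow> real) \<Rightarrow> real ^ 'd \<Rightarrow> real" where
  "partial_deriv i f x = frechet_derivative f (at x) (axis i 1)"

text \<open>\<open>f\<close> is of class \<open>C\<^sup>k\<close> on the set \<open>S\<close>; only meant for open \<open>S\<close>.\<close>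

primrec Ck_on :: "nat \<Rightarrow> (real ^ 'd::finite \<Rightarrow> real) \<Rightarrow> (real ^ 'd) set \<Rightarrow> bool" where
  "Ck_on 0 f S \<longleftrightarrow> continuous_on S f"
| "Ck_on (Suc k) f S \<longleftrightarrow> f differentiable_on S \<and> (\<forall>i. Ck_on k (partial_deriv i f) S)"

definition Ck_per :: "nat \<Rightarrow> (real ^ 'd::finite \<Rightarrow> real) set" where
  "Ck_per k = {f. periodic f \<and> Ck_on k f UNIV}"

definition hessian :: "(real ^ 'd::finite \<Rightarrow> real) \<Rightarrow> real ^ 'd \<Rightarrow> real ^ 'd ^ 'd" where
  "hessian f x = (\<chi> i j. partial_deriv i (partial_deriv j f) x)"

definition pos_definite :: "real ^ 'd ^ 'd \<Rightarrow> bool" where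
  "pos_definite A \<longleftrightarrow> (\<forall>v::real ^ 'd. v \<noteq> 0 \<longrightarrow> 0 < v \<bullet> (A *v v))"

section \<open>Minimizers\<close>

definition argmin :: "('a \<Rightarrow> real) \<Rightarrow> 'a set" where
  "argmin f = {y. is_arg_min f (\<lambda>_. True) y}"

definition is_min_value :: "('a \<Rightarrow> real) \<Rightarrow> real \<Rightarrow> bool" where
  "is_min_value f m \<longleftrightarrow> (\<exists>y\<in>argmin f. m = f y)"

section \<open>The potential and the weak KAM solution\<close>

text \<open>A minimum over \<open>\<T>\<^sup>d\<close> attained exactly at \<open>0\<close> means, for the lift to \<open>\<real>\<^sup>d\<close>,
  that the set of minimizers is exactly \<open>\<int>\<^sup>d\<close>.\<close>

definition admissible_potential :: "(real ^ 'd::finite \<Rightarrow> real) \<Rightarrow> bool" where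
  "admissible_potential F \<longleftrightarrow>
     F \<in> Ck_per 3 \<and> F 0 = 0 \<and> argmin F = int_lattice \<and> pos_definite (hessian F 0)"

definition h :: "(real ^ 'd::finite \<Rightarrow> real) \<Rightarrow> real ^ 'd \<Rightarrow> real ^ 'd \<Rightarrow> real" where
  "h F y x = (1/2) * (norm (x - y))\<^sup>2 + F y"

definition h_psi ::
  "(real ^ 'd::finite \<Rightarrow> real) \<Rightarrow> (real ^ 'd \<Rightarrow> real) \<Rightarrow> real ^ 'd \<Rightarrow> real ^ 'd \<Rightarrow> real" where
  "h_psi F \<psi> y x = \<psi> y + h F y x"

definition h_tilde ::
  "(real ^ 'd::finite \<Rightarrow> real) \<Rightarrow> (real ^ 'd \<Rightarrow> real) \<Rightarrow> real ^ 'd \<Rightarrow> real ^ 'd \<Rightarrow> real" where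
  "h_tilde F \<psi> y x = h F y x + \<psi> y - \<psi> x"

definition weak_kam_solution :: "(real ^ 'd::finite \<Rightarrow> real) \<Rightarrow> (real ^ 'd \<Rightarrow> real) \<Rightarrow> bool" where
  "weak_kam_solution F \<psi> \<longleftrightarrow>
     \<psi> \<in> Ck_per 0 \<and> \<psi> 0 = 0 \<and> (\<forall>x. is_min_value (\<lambda>y. \<psi> y + h F y x) (\<psi> x))"

text \<open>Meaningful only where the minimizer is unique, in particular wherever \<open>\<psi>\<close> is
  differentiable.\<close>

definition ybar ::
  "(real ^ 'd::finite \<Rightarrow> real) \<Rightarrow> (real ^ 'd \<Rightarrow> real) \<Rightarrow> real ^ 'd \<Rightarrow> real ^ 'd" where
  "ybar F \<psi> x = (THE y. y \<in> argmin (\<lambda>y. h_psi F \<psi> y x))"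

definition D_minus ::
  "(real ^ 'd::finite \<Rightarrow> real) \<Rightarrow> (real ^ 'd \<Rightarrow> real) \<Rightarrow> (real ^ 'd) set" where
  "D_minus F \<psi> = (\<Union>x. argmin (\<lambda>y. h_psi F \<psi> y x))"

definition admissible_nbhd ::
  "(real ^ 'd::finite \<Rightarrow> real) \<Rightarrow> (real ^ 'd \<Rightarrow> real) \<Rightarrow> real \<Rightarrow> (real ^ 'd) set \<Rightarrow> bool" where
  "admissible_nbhd F \<psi> \<delta> U \<longleftrightarrow>
     open U \<and> periodic (\<lambda>x. x \<in> U) \<and> D_minus F \<psi> \<subseteq> U \<and>
     Ck_on 3 \<psi> U \<and> bounded (hessian \<psi> ` U) \<and>
     (\<forall>x\<in>U. \<forall>y. h_psi F \<psi> y x - h_psi F \<psi> (ybar F \<psi> x) x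
                    \<ge> \<delta> * (norm (y - ybar F \<psi> x))\<^sup>2) \<and>
     (\<forall>x. \<forall>y. y \<notin> U \<longrightarrow> h_psi F \<psi> y x - (INF z. h_psi F \<psi> z x) \<ge> \<delta>)"

section \<open>The rescaled transfer operator\<close>

definition chi_nu :: "(real ^ 'd::finite) set \<Rightarrow> real \<Rightarrow> real ^ 'd \<Rightarrow> real" where
  "chi_nu U \<nu> x = (if x \<in> U then 1 else \<nu> powr (- (real CARD('d) / 2)))"

definition K_tilde ::
  "(real ^ 'd::finite \<Rightarrow> real) \<Rightarrow> (real ^ 'd \<Rightarrow> real) \<Rightarrow> real \<Rightarrow> real ^ 'd \<Rightarrow> real ^ 'd \<Rightarrow> real" where
  "K_tilde F \<psi> \<nu> y x =
     (4 * pi * \<nu>) powr (- (real CARD('d) / 2)) * exp (- (1 / (2 * \<nu>)) * h_tilde F \<psi> y x)"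

definition L_tilde ::
  "(real ^ 'd::finite \<Rightarrow> real) \<Rightarrow> (real ^ 'd \<Rightarrow> real) \<Rightarrow> real
     \<Rightarrow> (real ^ 'd \<Rightarrow> real) \<Rightarrow> real ^ 'd \<Rightarrow> real" where
  "L_tilde F \<psi> \<nu> u x = (LINT y|lborel. K_tilde F \<psi> \<nu> y x * u y)"

end

theory Submission
  imports Defs "HOL-Probability.Distributions"
begin

text \<open>
  Why the bounds hold.  Write \<open>s = sqrt \<psi>\<close>, let \<open>D\<close> be the distance to the lattice, and call
  \<open>y\<close> calibrated to \<open>x\<close> if it minimizes \<open>h_psi F \<psi> \<cdot> x\<close>.  The kernel concentrates on such \<open>y\<close> at scale
  \<open>sqrt \<nu>\<close>.  Near the lattice the exponent \<open>h_tilde\<close> is, to leading order, one fixed positive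
  quadratic form \<open>q\<close> of \<open>y' - y\<close>, so one application of the operator multiplies by the Gaussian integral \<open>\<kappa>\<close>
  of \<open>q\<close>.  The theorem is proved with \<open>Q n = \<kappa> ^ n\<close>.

  Two errors have to be controlled over many steps.  For \<open>x \<in> U\<close> the energy at \<open>y + v\<close> differs from \<open>q v\<close> by
  \<open>O((norm v + D y) * (norm v)\<^sup>2)\<close> (\<open>ht_approx_q\<close>).

  The part \<open>norm v\<close> costs a factor \<open>1 + O(sqrt \<nu>)\<close> per step.  In the
  admissible range \<open>n \<le> \<nu> powr (- 1/3)\<close>, hence \<open>n * sqrt \<nu> \<le> \<nu> powr (1/6)\<close>, and the accumulated factor
  stays bounded.

  The part \<open>D y\<close> does not become small with \<open>\<nu>\<close>, but it is summable along the backward orbit: \<open>s\<close> is a Lyapunov function,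
  with \<open>s y + c * D y \<le> s x\<close> for \<open>y\<close> calibrated to \<open>x\<close> (\<open>s_decrease\<close>).  So the weights
  \<open>exp (K * s)\<close> and \<open>exp (- K * s)\<close> absorb it once \<open>K\<close> is large.  Since \<open>s\<close> is moreover bounded and Lipschitz, a weight of this
  kind costs only another \<open>1 + O(sqrt \<nu>)\<close> when it is moved from \<open>y + sqrt \<nu> w\<close> to \<open>y\<close>.

  This gives a supersolution equal to \<open>exp (K * s)\<close> on \<open>U\<close> and to a multiple of \<open>\<nu> powr (- d/2)\<close> off \<open>U\<close>
  (\<open>supersolution\<close>), and a subsolution equal to \<open>exp (- K * s)\<close> on \<open>U\<close> and to zero off \<open>U\<close> (\<open>subsolution\<close>).
  Mass outside \<open>U\<close> is exponentially suppressed because \<open>h_tilde \<ge> \<delta>\<close> there, which beats the power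
  of \<open>\<nu>\<close>.  Monotonicity of the operator turns the two into bounds for its iterates.
  The lower bound off \<open>U\<close> comes from applying the operator once more to the subsolution
  (\<open>L_sub_lower_bound\<close>).
\<close>

section \<open>Second-order calculus along lines\<close>

lemma has_derivative_partial_deriv:
  fixes f :: "real ^ 'd::finite \<Rightarrow> real"
  assumes "f differentiable (at x)"
  shows "(f has_derivative (\<lambda>v. \<Sum>i\<in>UNIV. v $ i * partial_deriv i f x)) (at x)"
proof -
  let ?f' = "frechet_derivative f (at x)"
  have der: "(f has_derivative ?f') (at x)"
    using assms frechet_derivative_works by blast
  then interpret linear ?f' by (rule has_derivative_linear)
  have "?f' v = (\<Sum>i\<in>UNIV. v $ i * partial_deriv i f x)" for v
  proof -
    have "?f' v = ?f' (\<Sum>i\<in>UNIV. v $ i *\<^sub>R axis i 1)"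
      using basis_expansion[of v] by (simp add: scalar_mult_eq_scaleR)
    also have "\<dots> = (\<Sum>i\<in>UNIV. v $ i * partial_deriv i f x)"
      by (simp add: sum scale partial_deriv_def)
    finally show ?thesis .
  qed
  then have "?f' = (\<lambda>v. \<Sum>i\<in>UNIV. v $ i * partial_deriv i f x)" by blast
  with der show ?thesis by (simp only:)
qed

lemma has_real_derivative_along_line:
  fixes f :: "real ^ 'd::finite \<Rightarrow> real"
  assumes "f differentiable (at (a + t *\<^sub>R v))"
  shows "((\<lambda>t. f (a + t *\<^sub>R v)) has_real_derivative
     (\<Sum>i\<in>UNIV. v $ i * partial_deriv i f (a + t *\<^sub>R v))) (at t)"
proof -
  have l: "((\<lambda>t. a + t *\<^sub>R v) has_derivative (\<lambda>s. s *\<^sub>R v)) (at t)"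
    by (auto intro!: derivative_eq_intros)
  have "((\<lambda>t. f (a + t *\<^sub>R v)) has_derivative
     (\<lambda>s. \<Sum>i\<in>UNIV. (s *\<^sub>R v) $ i * partial_deriv i f (a + t *\<^sub>R v))) (at t)"
    using has_derivative_compose[OF l has_derivative_partial_deriv[OF assms]] .
  then show ?thesis
    by (rule has_derivative_imp_has_field_derivative)
      (simp add: sum_distrib_right sum_distrib_left mult_ac)
qed

text \<open>Pointwise differentiability instead of the within-derivatives of \<^const>\<open>Ck_on\<close>, so that it can
  be composed with lines.\<close>

definition C2_on :: "(real ^ 'd::finite \<Rightarrow> real) \<Rightarrow> (real ^ 'd) set \<Rightarrow> bool" where
  "C2_on f S \<longleftrightarrow> (\<forall>x\<in>S. f differentiable (at x)) \<and>
     (\<forall>x\<in>S. \<forall>i. partial_deriv i f differentiable (at x))"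

definition C3_on :: "(real ^ 'd::finite \<Rightarrow> real) \<Rightarrow> (real ^ 'd) set \<Rightarrow> bool" where
  "C3_on f S \<longleftrightarrow> C2_on f S \<and>
     (\<forall>x\<in>S. \<forall>i j. partial_deriv i (partial_deriv j f) differentiable (at x))"

lemma C2_on_continuous: "C2_on f S \<Longrightarrow> continuous_on S f"
  unfolding C2_on_def
  by (meson differentiable_imp_continuous_within continuous_at_imp_continuous_on)

lemma Ck_on_3_imp:
  assumes "Ck_on 3 f S" "open S"
  shows "C3_on f S"
  using assms by (auto simp: numeral_3_eq_3 C2_on_def C3_on_def differentiable_on_eq_differentiable_at)

lemma quadratic_form_hessian:
  "v \<bullet> (hessian f x *v v) =
    (\<Sum>i\<in>UNIV. v $ i * (\<Sum>j\<in>UNIV. v $ j * partial_deriv j (partial_deriv i f) x))"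
proof -
  have "v \<bullet> (hessian f x *v v) =
    (\<Sum>j\<in>UNIV. \<Sum>i\<in>UNIV. v $ j * (partial_deriv j (partial_deriv i f) x * v $ i))"
    by (simp add: inner_vec_def matrix_vector_mult_def hessian_def sum_distrib_left)
  also have "\<dots> = (\<Sum>i\<in>UNIV. \<Sum>j\<in>UNIV. v $ j * (partial_deriv j (partial_deriv i f) x * v $ i))"
    by (rule sum.swap)
  finally show ?thesis by (simp add: sum_distrib_left mult_ac)
qed

lemma second_derivative_along_line:
  fixes f :: "real ^ 'd::finite \<Rightarrow> real"
  assumes "C2_on f S" "a + t *\<^sub>R v \<in> S"
  shows "((\<lambda>t. \<Sum>i\<in>UNIV. v $ i * partial_deriv i f (a + t *\<^sub>R v)) has_real_derivative
     v \<bullet> (hessian f (a + t *\<^sub>R v) *v v)) (at t)"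
  unfolding quadratic_form_hessian
  using assms unfolding C2_on_def
  by (auto intro!: DERIV_sum DERIV_cmult has_real_derivative_along_line)

text \<open>At an interior minimum the first-order term vanishes, so a vanishing minimum
  value leaves only the second-order remainder.\<close>

lemma taylor2_at_minimum:
  fixes g g' g'' :: "real \<Rightarrow> real"
  assumes "\<And>t. 0 \<le> t \<Longrightarrow> t \<le> 1 \<Longrightarrow> (g has_real_derivative g' t) (at t)"
    and "\<And>t. 0 \<le> t \<Longrightarrow> t \<le> 1 \<Longrightarrow> (g' has_real_derivative g'' t) (at t)"
    and "g 0 = 0" and "\<And>t. g t \<ge> 0"
  obtains t where "0 \<le> t" "t \<le> 1" "g 1 = g'' t / 2"
proof -
  have "g' 0 = 0"
    by (rule DERIV_local_min[where d=1 and x=0 and f=g]) (use assms in auto)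
  define diff where "diff m = (if m = 0 then g else if m = (1::nat) then g' else g'')" for m
  have "\<exists>t>0. t \<le> 1 \<and> g 1 = (\<Sum>m<2. diff m 0 / fact m * 1 ^ m) + diff 2 t / fact 2 * 1 ^ 2"
    by (rule Maclaurin2) (use assms in \<open>auto simp: diff_def less_2_cases_iff\<close>)
  then obtain t where "t > 0" "t \<le> 1"
     "g 1 = (\<Sum>m<2. diff m 0 / fact m * 1 ^ m) + diff 2 t / fact 2 * 1 ^ 2" by blast
  then have "g 1 = g'' t / 2"
    using assms \<open>g' 0 = 0\<close> by (simp add: diff_def numeral_2_eq_2)
  with \<open>t > 0\<close> \<open>t \<le> 1\<close> show ?thesis by (intro that[of t]) auto
qed

lemma quadratic_form_le:
  fixes A :: "real ^ 'd::finite ^ 'd"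
  assumes "\<And>i j. \<bar>A $ i $ j\<bar> \<le> e"
  shows "\<bar>v \<bullet> (A *v v)\<bar> \<le> e * real CARD('d)^2 * (norm v)\<^sup>2"
proof -
  have "\<bar>v \<bullet> (A *v v)\<bar> = \<bar>\<Sum>i\<in>UNIV. \<Sum>j\<in>UNIV. v $ i * (A $ i $ j * v $ j)\<bar>"
    by (simp add: inner_vec_def matrix_vector_mult_def sum_distrib_left)
  also have "\<dots> \<le> (\<Sum>i\<in>UNIV. \<Sum>j\<in>UNIV. \<bar>v $ i * (A $ i $ j * v $ j)\<bar>)"
    by (intro order_trans[OF sum_abs] sum_mono order.refl)
  also have "\<dots> \<le> (\<Sum>i\<in>(UNIV::'d set). \<Sum>j\<in>(UNIV::'d set). norm v * (e * norm v))"
    using assms by (intro sum_mono) (auto simp: abs_mult intro!: mult_mono component_le_norm_cart order_trans[OF abs_ge_zero assms])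
  finally show ?thesis by (simp add: power2_eq_square mult_ac)
qed

lemma differentiable_imp_lipschitz_at:
  fixes f :: "'a::real_normed_vector \<Rightarrow> real"
  assumes "f differentiable (at a)"
  obtains L r where "r > 0" "L \<ge> 0" "\<And>x. norm (x - a) < r \<Longrightarrow> \<bar>f x - f a\<bar> \<le> L * norm (x - a)"
proof -
  obtain f' where f': "(f has_derivative f') (at a)"
    using assms differentiable_def by blast
  then interpret bounded_linear f' by (rule has_derivative_bounded_linear)
  obtain r where r: "r > 0" "\<And>x. norm (x - a) < r \<Longrightarrow> norm (f x - f a - f' (x - a)) \<le> 1 * norm (x - a)"
    using f' unfolding has_derivative_at_alt by (meson zero_less_one)
  obtain B where B: "\<And>x. norm (f' x) \<le> norm x * B" "B \<ge> 0" using nonneg_bounded by blast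
  show ?thesis
  proof (rule that[of r "B + 1"])
    fix x assume "norm (x - a) < r"
    from r(2)[OF this] B(1)[of "x - a"] show "\<bar>f x - f a\<bar> \<le> (B + 1) * norm (x - a)"
      by (auto simp: algebra_simps)
  qed (use r B in auto)
qed

text \<open>The Lipschitz bound is centred at \<open>a\<close> and comes from the derivatives of the second partial derivatives
  at that point.\<close>

lemma hessian_lipschitz_at:
  fixes f :: "real ^ 'd::finite \<Rightarrow> real"
  assumes "C3_on f S" "a \<in> S"
  obtains L r where "r > 0" "L \<ge> 0"
    "\<And>x v. norm (x - a) < r \<Longrightarrow>
      \<bar>v \<bullet> (hessian f x *v v) - v \<bullet> (hessian f a *v v)\<bar> \<le> L * norm (x - a) * (norm v)\<^sup>2"
proof -
  have "\<exists>L r. r > 0 \<and> L \<ge> 0 \<and> (\<forall>x. norm (x - a) < r \<longrightarrow>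
      \<bar>partial_deriv i (partial_deriv j f) x - partial_deriv i (partial_deriv j f) a\<bar> \<le> L * norm (x - a))" for i j
    using assms differentiable_imp_lipschitz_at[of "partial_deriv i (partial_deriv j f)" a]
    unfolding C3_on_def by metis
  then obtain L r where r: "\<And>i j. r i j > 0" and L: "\<And>i j. L i j \<ge> 0" and
    *: "\<And>i j x. norm (x - a) < r i j \<Longrightarrow>
      \<bar>partial_deriv i (partial_deriv j f) x - partial_deriv i (partial_deriv j f) a\<bar> \<le> L i j * norm (x - a)"
    by metis
  define r0 where "r0 = Min (range (\<lambda>(i,j). r i j))"
  define L0 where "L0 = Max (range (\<lambda>(i,j). L i j))"
  have r0: "r0 > 0" "r0 \<le> r i j" for i j
    using r unfolding r0_def by (auto intro!: Min_le rangeI[of _ "(i,j)", simplified])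
  have L0: "L0 \<ge> L i j" for i j
    unfolding L0_def by (auto intro!: Max_ge rangeI[of "\<lambda>(i,j). L i j" "(i,j)", simplified])
  then have "L0 \<ge> 0" using L order_trans by blast
  show ?thesis
  proof (rule that[of r0 "L0 * real CARD('d)^2"])
    fix x v assume x: "norm (x - a) < r0"
    have e: "\<bar>(hessian f x - hessian f a) $ i $ j\<bar> \<le> L0 * norm (x - a)" for i j
    proof -
      have "L i j * norm (x - a) \<le> L0 * norm (x - a)"
        by (intro mult_right_mono L0) auto
      with *[of x i j] x r0(2)[of i j] show ?thesis by (auto simp: hessian_def)
    qed
    from quadratic_form_le[OF e, of v]
    show "\<bar>v \<bullet> (hessian f x *v v) - v \<bullet> (hessian f a *v v)\<bar> \<le> L0 * real CARD('d)^2 * norm (x - a) * (norm v)\<^sup>2"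
      by (simp add: matrix_vector_mult_diff_rdistrib inner_diff_right mult_ac)
  qed (use r0 \<open>L0 \<ge> 0\<close> in auto)
qed

lemma half_norm_square_derivatives:
  fixes w v :: "'a::real_inner"
  shows "((\<lambda>t. (norm (w + t *\<^sub>R v))\<^sup>2 / 2) has_real_derivative (w + t *\<^sub>R v) \<bullet> v) (at t)"
    and "((\<lambda>t. (w + t *\<^sub>R v) \<bullet> v) has_real_derivative (norm v)\<^sup>2) (at t)"
proof -
  have "(\<lambda>t. (norm (w + t *\<^sub>R v))\<^sup>2 / 2) = (\<lambda>t. (w \<bullet> w + 2 * t * (w \<bullet> v) + t\<^sup>2 * (v \<bullet> v)) / 2)"
    unfolding power2_norm_eq_inner by (auto simp: inner_simps inner_commute power2_eq_square algebra_simps)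
  moreover have "((\<lambda>t. (w \<bullet> w + 2 * t * (w \<bullet> v) + t\<^sup>2 * (v \<bullet> v)) / 2) has_real_derivative (w + t *\<^sub>R v) \<bullet> v) (at t)"
    by (auto intro!: derivative_eq_intros simp: inner_simps)
  ultimately show "((\<lambda>t. (norm (w + t *\<^sub>R v))\<^sup>2 / 2) has_real_derivative (w + t *\<^sub>R v) \<bullet> v) (at t)"
    by simp
  show "((\<lambda>t. (w + t *\<^sub>R v) \<bullet> v) has_real_derivative (norm v)\<^sup>2) (at t)"
    unfolding power2_norm_eq_inner inner_simps by (auto intro!: derivative_eq_intros)
qed

text \<open>The form attains its minimum over the unit sphere.\<close>

lemma pos_definite_lower_bound:
  fixes A :: "real ^ 'd::finite ^ 'd"
  assumes "pos_definite A"
  obtains m where "m > 0" "\<And>v. m * (norm v)\<^sup>2 \<le> v \<bullet> (A *v v)"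
proof -
  have "\<exists>u\<in>sphere 0 1. \<forall>v\<in>sphere 0 1. u \<bullet> (A *v u) \<le> v \<bullet> (A *v (v :: real ^ 'd))"
  proof (rule continuous_attains_inf)
    have "axis undefined 1 \<in> sphere (0 :: real ^ 'd) 1" by (simp add: norm_axis_1)
    then show "sphere (0 :: real ^ 'd) 1 \<noteq> {}" by blast
    show "continuous_on (sphere 0 1) (\<lambda>v. v \<bullet> (A *v v))"
      by (intro continuous_intros linear_continuous_on matrix_vector_mul_bounded_linear)
  qed auto
  then obtain u where u: "norm u = 1" "\<And>v. norm v = 1 \<Longrightarrow> u \<bullet> (A *v u) \<le> v \<bullet> (A *v v)" by auto
  show ?thesis
  proof (rule that)
    show "u \<bullet> (A *v u) > 0" using assms u(1) unfolding pos_definite_def by (metis norm_zero zero_neq_one)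
    fix v
    show "u \<bullet> (A *v u) * (norm v)\<^sup>2 \<le> v \<bullet> (A *v v)"
    proof (cases "v = 0")
      case False
      then have "u \<bullet> (A *v u) \<le> (v /\<^sub>R norm v) \<bullet> (A *v (v /\<^sub>R norm v))" by (intro u(2)) auto
      also have "\<dots> = v \<bullet> (A *v v) / (norm v)\<^sup>2"
        by (simp add: matrix_vector_mult_scaleR power2_eq_square divide_simps)
      finally show ?thesis using False by (simp add: field_simps)
    qed auto
  qed
qed

section \<open>The integer lattice\<close>

lemma int_lattice_add: "k \<in> int_lattice \<Longrightarrow> l \<in> int_lattice \<Longrightarrow> k + l \<in> int_lattice"
  and int_lattice_minus: "k \<in> int_lattice \<Longrightarrow> - k \<in> int_lattice"
  and zero_in_int_lattice: "0 \<in> int_lattice"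
  by (auto simp: int_lattice_def)

lemma closed_int_lattice: "closed (int_lattice :: (real ^ 'd::finite) set)"
proof -
  have "int_lattice = (\<Inter>i. {k :: real ^ 'd. k $ i \<in> \<int>})"
    by (auto simp: int_lattice_def)
  moreover have "closed {k :: real ^ 'd. k $ i \<in> \<int>}" for i
    using closed_vimage[OF closed_Ints, of "\<lambda>k :: real ^ 'd. k $ i"]
    by (simp add: vimage_def continuous_on_component)
  ultimately show ?thesis by (metis (no_types, lifting) closed_INT)
qed

text \<open>\<^const>\<open>frechet_derivative\<close> is a choice among all derivatives, and translation by a period
  preserves the set of derivatives to choose from, hence also the chosen one.\<close>

lemma periodic_partial_deriv:
  fixes f :: "real ^ 'd::finite \<Rightarrow> real"
  assumes "periodic f"
  shows "periodic (partial_deriv i f)"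
  unfolding periodic_def
proof (intro allI ballI)
  fix x k :: "real ^ 'd" assume k: "k \<in> int_lattice"
  have sh: "(f has_derivative f') (at (x + k))" if "(f has_derivative f') (at x)" "k \<in> int_lattice"
    for f' and x k :: "real ^ 'd"
  proof -
    have l: "((\<lambda>y. y - k) has_derivative (\<lambda>v. v)) (at (x + k))"
      by (auto intro!: derivative_eq_intros)
    have "((\<lambda>y. f (y - k)) has_derivative (\<lambda>v. f' v)) (at (x + k))"
      by (rule has_derivative_compose[OF l]) (use that in simp)
    moreover have "f (y - k) = f y" for y
      using assms that int_lattice_minus[of k] unfolding periodic_def by (metis diff_conv_add_uminus)
    ultimately show ?thesis by simp
  qed
  have "(f has_derivative f') (at (x + k)) \<longleftrightarrow> (f has_derivative f') (at x)" for f'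
    using sh[of f' x k] sh[of f' "x + k" "- k"] k int_lattice_minus[of k] by auto
  then have "frechet_derivative f (at (x + k)) = frechet_derivative f (at x)"
    unfolding frechet_derivative_def by simp
  then show "partial_deriv i f (x + k) = partial_deriv i f x"
    by (simp add: partial_deriv_def)
qed

lemma periodic_hessian: "periodic f \<Longrightarrow> periodic (hessian f)"
  using periodic_partial_deriv[of "partial_deriv _ f"] periodic_partial_deriv[of f]
  unfolding periodic_def hessian_def by simp

lemma periodic_minus:
  "periodic f \<Longrightarrow> k \<in> int_lattice \<Longrightarrow> f (x - k) = f x"
  using int_lattice_minus[of k] unfolding periodic_def by (metis diff_conv_add_uminus)

lemma lattice_reduction:
  fixes x :: "real ^ 'd::finite"
  obtains k where "k \<in> int_lattice" "x - k \<in> cbox 0 1"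
proof (rule that[of "\<chi> i. of_int \<lfloor>x $ i\<rfloor>"])
  show "x - (\<chi> i. of_int \<lfloor>x $ i\<rfloor>) \<in> cbox 0 1"
    by (auto simp: mem_box_cart) linarith
qed (auto simp: int_lattice_def)

lemma periodic_continuous_bounded:
  fixes f :: "real ^ 'd::finite \<Rightarrow> real"
  assumes "periodic f" "continuous_on UNIV f"
  obtains B where "B \<ge> 0" "\<And>x. \<bar>f x\<bar> \<le> B"
proof -
  have "bounded (f ` cbox 0 1)"
    by (intro compact_imp_bounded compact_continuous_image continuous_on_subset[OF assms(2)]) auto
  then obtain B where B: "\<And>x. x \<in> cbox 0 1 \<Longrightarrow> \<bar>f x\<bar> \<le> B" unfolding bounded_iff by auto
  have "\<bar>f x\<bar> \<le> max B 0" for x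
  proof -
    obtain k where "k \<in> int_lattice" "x - k \<in> cbox 0 1" by (rule lattice_reduction)
    with B[of "x - k"] periodic_minus[OF assms(1)] show ?thesis by fastforce
  qed
  then show ?thesis using that[of "max B 0"] by auto
qed

abbreviation lattice_dist :: "real ^ 'd::finite \<Rightarrow> real" where
  "lattice_dist x \<equiv> infdist x int_lattice"

lemma nearest_lattice_point:
  fixes x :: "real ^ 'd::finite"
  obtains k where "k \<in> int_lattice" "lattice_dist x = norm (x - k)"
  using infdist_attains_inf[OF closed_int_lattice, of x] zero_in_int_lattice
  by (auto simp: dist_norm)

lemma lattice_dist_le: "k \<in> int_lattice \<Longrightarrow> lattice_dist x \<le> norm (x - k)"
  by (metis infdist_le dist_norm)

lemma periodic_lattice_dist: "periodic (lattice_dist :: real ^ 'd::finite \<Rightarrow> real)"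
proof -
  have le: "lattice_dist (x + k) \<le> lattice_dist x" if "k \<in> int_lattice" for x k :: "real ^ 'd"
  proof -
    obtain l where "l \<in> int_lattice" "lattice_dist x = norm (x - l)" by (rule nearest_lattice_point)
    then show ?thesis using lattice_dist_le[of "l + k" "x + k"] int_lattice_add that by auto
  qed
  show ?thesis unfolding periodic_def
    using le le[of "- _" "_ + _"] int_lattice_minus by (metis add_diff_cancel diff_conv_add_uminus order_antisym)
qed

lemma lattice_dist_add: "lattice_dist (x + v) \<le> lattice_dist x + norm v"
  using infdist_triangle[of "x + v" int_lattice x] by (simp add: dist_norm)

lemma lattice_dist_bounded:
  obtains R where "R > 0" "\<And>x :: real ^ 'd::finite. lattice_dist x \<le> R"
proof -
  obtain B where B: "\<And>x :: real ^ 'd. \<bar>lattice_dist x\<bar> \<le> B" "B \<ge> 0"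
    using periodic_continuous_bounded[OF periodic_lattice_dist continuous_on_infdist[OF continuous_on_id]]
    by blast
  have "lattice_dist x \<le> B + 1" for x :: "real ^ 'd" using B(1)[of x] by linarith
  with B(2) show ?thesis by (intro that[of "B + 1"]) auto
qed

text \<open>Near the lattice this is the Lipschitz bound at \<open>0\<close>, moved by periodicity; at distance at least \<open>r\<close>
  the bound \<open>2 * B\<close> on the difference is itself at most \<open>2 * B / r\<close> times the distance.\<close>

lemma hessian_lipschitz_lattice_dist:
  fixes f :: "real ^ 'd::finite \<Rightarrow> real"
  assumes per: "periodic f" and C3: "C3_on f S" "0 \<in> S"
    and B: "\<And>x v. x \<in> S \<Longrightarrow> \<bar>v \<bullet> (hessian f x *v v)\<bar> \<le> B * (norm v)\<^sup>2"
  obtains L where "L \<ge> 0"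
    "\<And>x v. x \<in> S \<Longrightarrow>
      \<bar>v \<bullet> (hessian f x *v v) - v \<bullet> (hessian f 0 *v v)\<bar> \<le> L * lattice_dist x * (norm v)\<^sup>2"
proof -
  obtain r L where r: "r > 0" "L \<ge> 0"
    and L: "\<And>x v. norm (x - 0) < r \<Longrightarrow>
      \<bar>v \<bullet> (hessian f x *v v) - v \<bullet> (hessian f 0 *v v)\<bar> \<le> L * norm (x - 0) * (norm v)\<^sup>2"
    using hessian_lipschitz_at[OF C3] by metis
  have "\<bar>v \<bullet> (hessian f x *v v) - v \<bullet> (hessian f 0 *v v)\<bar> \<le> max L (2 * B / r) * lattice_dist x * (norm v)\<^sup>2"
    if "x \<in> S" for x v
  proof (cases "lattice_dist x < r")
    case True
    obtain k where k: "k \<in> int_lattice" "lattice_dist x = norm (x - k)" by (rule nearest_lattice_point)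
    have "hessian f (x - k) = hessian f x"
      using periodic_minus[OF periodic_hessian[OF per] k(1)] .
    with L[of "x - k" v] k True
    have "\<bar>v \<bullet> (hessian f x *v v) - v \<bullet> (hessian f 0 *v v)\<bar> \<le> L * lattice_dist x * (norm v)\<^sup>2"
      by simp
    also have "\<dots> \<le> max L (2 * B / r) * lattice_dist x * (norm v)\<^sup>2"
      by (intro mult_right_mono) (auto simp: infdist_nonneg)
    finally show ?thesis .
  next
    case False
    have "\<bar>v \<bullet> (hessian f x *v v) - v \<bullet> (hessian f 0 *v v)\<bar> \<le> 2 * B * (norm v)\<^sup>2"
      using B[OF that, of v] B[OF C3(2), of v] by linarith
    also have "\<dots> = (2 * B * (norm v)\<^sup>2 / r) * r" using r by simp
    also have "\<dots> \<le> (2 * B * (norm v)\<^sup>2 / r) * lattice_dist x"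
    proof (rule mult_left_mono)
      have "0 \<le> B * (norm v)\<^sup>2" using B[OF that, of v] by linarith
      then show "0 \<le> 2 * B * (norm v)\<^sup>2 / r" using r by simp
    qed (use False in auto)
    also have "\<dots> = 2 * B / r * lattice_dist x * (norm v)\<^sup>2" by simp
    also have "\<dots> \<le> max L (2 * B / r) * lattice_dist x * (norm v)\<^sup>2"
      by (intro mult_right_mono) (auto simp: infdist_nonneg)
    finally show ?thesis .
  qed
  with r show ?thesis by (intro that[of "max L (2 * B / r)"]) auto
qed

section \<open>Gaussian integrals and elementary bounds\<close>

lemma
  fixes f :: "'a::euclidean_space \<Rightarrow> real" and c :: real
  assumes c: "c \<noteq> 0" and f[measurable]: "f \<in> borel_measurable borel"
  shows lborel_integral_affine:
      "(LINT x|lborel. f x) = \<bar>c\<bar> ^ DIM('a) * (LINT x|lborel. f (t + c *\<^sub>R x))"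
    and lborel_integrable_affine_iff:
      "integrable lborel f \<longleftrightarrow> integrable lborel (\<lambda>x. f (t + c *\<^sub>R x))"
proof -
  have lb: "lborel = density (distr lborel borel (\<lambda>x::'a. t + c *\<^sub>R x)) (\<lambda>_. ennreal (\<bar>c\<bar> ^ DIM('a)))"
    using lborel_affine[OF c, of t] by simp
  have "(LINT x|lborel. f x) =
      (LINT x|density (distr lborel borel (\<lambda>x. t + c *\<^sub>R x)) (\<lambda>_. ennreal (\<bar>c\<bar> ^ DIM('a))). f x)"
    using lb by simp
  also have "\<dots> = \<bar>c\<bar> ^ DIM('a) * (LINT x|lborel. f (t + c *\<^sub>R x))"
    by (simp add: integral_density integral_distr)
  finally show "(LINT x|lborel. f x) = \<bar>c\<bar> ^ DIM('a) * (LINT x|lborel. f (t + c *\<^sub>R x))" .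
  have "integrable lborel f \<longleftrightarrow>
      integrable (density (distr lborel borel (\<lambda>x. t + c *\<^sub>R x)) (\<lambda>_. ennreal (\<bar>c\<bar> ^ DIM('a)))) f"
    using lb by simp
  also have "\<dots> \<longleftrightarrow> integrable lborel (\<lambda>x. f (t + c *\<^sub>R x))"
    using c by (simp add: integrable_density integrable_distr_eq)
  finally show "integrable lborel f \<longleftrightarrow> integrable lborel (\<lambda>x. f (t + c *\<^sub>R x))" .
qed

lemma integrable_gaussian:
  assumes "a > 0"
  shows "integrable lborel (\<lambda>w :: 'a::euclidean_space. exp (- a * (norm w)\<^sup>2))"
proof -
  define \<sigma> where "\<sigma> = sqrt (1 / (2 * a))"
  have \<sigma>: "\<sigma> > 0" "\<sigma>\<^sup>2 = 1 / (2 * a)" using assms by (auto simp: \<sigma>_def)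
  have "exp (- a * x\<^sup>2) = sqrt (2 * pi * \<sigma>\<^sup>2) * normal_density 0 \<sigma> x" for x
    using \<sigma> assms by (simp add: normal_density_def field_simps)
  then have int1: "integrable lborel (\<lambda>x::real. exp (- a * x\<^sup>2))"
    using \<sigma> by simp
  have "(\<integral>\<^sup>+w. exp (- a * (norm (w :: 'a))\<^sup>2) \<partial>lborel)
      = (\<integral>\<^sup>+w. (\<Prod>b\<in>(Basis::'a set). ennreal (exp (- a * (w \<bullet> b)\<^sup>2))) \<partial>lborel)"
  proof (rule nn_integral_cong)
    fix w :: 'a
    have "(norm w)\<^sup>2 = (\<Sum>b\<in>Basis. (w \<bullet> b)\<^sup>2)"
      unfolding norm_eq_sqrt_inner by (subst euclidean_inner) (simp add: power2_eq_square sum_nonneg)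
    then have "exp (- a * (norm w)\<^sup>2) = (\<Prod>b\<in>Basis. exp (- a * (w \<bullet> b)\<^sup>2))"
      by (simp add: sum_distrib_left exp_sum sum_negf[symmetric])
    then show "ennreal (exp (- a * (norm w)\<^sup>2)) = (\<Prod>b\<in>Basis. ennreal (exp (- a * (w \<bullet> b)\<^sup>2)))"
      by (simp add: prod_ennreal)
  qed
  also have "\<dots> = (\<Prod>b\<in>(Basis::'a set). \<integral>\<^sup>+x. exp (- a * x\<^sup>2) \<partial>lborel)"
    by (rule nn_integral_lborel_prod) auto
  also have "\<dots> < \<infinity>"
    using int1 by (auto simp: integrable_iff_bounded power_less_top_ennreal)
  finally show ?thesis by (auto simp: integrable_iff_bounded)
qed

lemma integrable_gaussian_weight:
  assumes "a > 0"
  shows "integrable lborel (\<lambda>w :: 'a::euclidean_space. (1 + norm w) ^ 4 * exp (- a * (norm w)\<^sup>2))"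
proof -
  define K where "K = max 1 (4 / a)"
  have K: "K \<ge> 1" "K * a / 4 \<ge> 1" using assms by (auto simp: K_def max_def field_simps)
  have b: "(1 + t) ^ 4 \<le> 4 * K\<^sup>2 * exp (a / 2 * t\<^sup>2)" if "t \<ge> 0" for t :: real
  proof -
    have "1 + t\<^sup>2 \<le> K + K * a / 4 * t\<^sup>2"
      using K mult_right_mono[OF K(2), of "t\<^sup>2"] by simp
    also have "\<dots> = K * (1 + a / 4 * t\<^sup>2)" by (simp add: algebra_simps)
    also have "\<dots> \<le> K * exp (a / 4 * t\<^sup>2)"
      using K by (intro mult_left_mono exp_ge_add_one_self) auto
    finally have 1: "1 + t\<^sup>2 \<le> K * exp (a / 4 * t\<^sup>2)" .
    have "(1 + t)\<^sup>2 \<le> 2 * (1 + t\<^sup>2)"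
      using zero_le_power2[of "1 - t"] by (simp add: power2_eq_square algebra_simps)
    then have "((1 + t)\<^sup>2)\<^sup>2 \<le> (2 * (K * exp (a / 4 * t\<^sup>2)))\<^sup>2"
      using 1 by (intro power_mono) auto
    also have "\<dots> = 4 * K\<^sup>2 * exp (a / 2 * t\<^sup>2)"
      by (simp add: power_mult_distrib exp_double[symmetric])
    finally show ?thesis by simp
  qed
  show ?thesis
  proof (rule Bochner_Integration.integrable_bound)
    show "integrable lborel (\<lambda>w :: 'a. 4 * K\<^sup>2 * exp (- (a / 2) * (norm w)\<^sup>2))"
      using assms integrable_gaussian[of "a / 2"] by (intro integrable_mult_right) auto
    have "(1 + norm w) ^ 4 * exp (- a * (norm w)\<^sup>2) \<le> 4 * K\<^sup>2 * exp (- (a / 2) * (norm w)\<^sup>2)" for w :: 'a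
    proof -
      have "(1 + norm w) ^ 4 * exp (- a * (norm w)\<^sup>2) \<le> 4 * K\<^sup>2 * exp (a / 2 * (norm w)\<^sup>2) * exp (- a * (norm w)\<^sup>2)"
        by (intro mult_right_mono b) auto
      also have "\<dots> = 4 * K\<^sup>2 * exp (- (a / 2) * (norm w)\<^sup>2)"
        by (simp add: exp_add[symmetric] mult.assoc)
      finally show ?thesis .
    qed
    then show "AE w :: 'a in lborel. norm ((1 + norm w) ^ 4 * exp (- a * (norm w)\<^sup>2)) \<le>
        norm (4 * K\<^sup>2 * exp (- (a / 2) * (norm w)\<^sup>2))" by simp
  qed measurable
qed

lemma integral_pos_of_pos:
  fixes f :: "'a::euclidean_space \<Rightarrow> real"
  assumes "integrable lborel f" "\<And>x. f x > 0"
  shows "(LINT x|lborel. f x) > 0"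
proof -
  have "(LINT x|lborel. f x) \<noteq> 0"
  proof
    assume "(LINT x|lborel. f x) = 0"
    then have "AE x in lborel. f x = 0"
      using assms by (subst (asm) integral_nonneg_eq_0_iff_AE) (auto simp: less_imp_le)
    then have "AE x in (lborel :: 'a measure). False"
      by eventually_elim (use assms(2) in \<open>auto simp: less_le\<close>)
    then show False by (simp add: trivial_limit_def[symmetric] ae_filter_eq_bot_iff)
  qed
  moreover have "(LINT x|lborel. f x) \<ge> 0" using assms(2) by (simp add: less_imp_le)
  ultimately show ?thesis by linarith
qed

lemma power_le_exp:
  fixes b z :: real
  assumes "b > 0" "z \<ge> 0" "n > 0"
  shows "z ^ n \<le> (real n / b) ^ n * exp (b * z)"
proof -
  have "(b * z / real n) ^ n \<le> (1 + b * z / real n) ^ n"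
    using assms by (intro power_mono) auto
  also have "\<dots> \<le> exp (b * z)"
    using assms order_trans[of "- real n" 0 "b * z"] by (intro exp_ge_one_plus_x_over_n_power_n) auto
  finally have "(real n / b) ^ n * (b * z / real n) ^ n \<le> (real n / b) ^ n * exp (b * z)"
    using assms by (intro mult_left_mono) auto
  then show ?thesis using assms by (simp add: power_mult_distrib[symmetric])
qed

text \<open>The cost of leaving \<open>U\<close> is \<open>exp (- b / \<nu>)\<close> for some \<open>b\<close>; it outweighs the factor \<open>\<nu> powr (- d)\<close>
  and leaves \<open>sqrt \<nu>\<close> to spare.\<close>

lemma singular_power_le_exp:
  fixes b d :: real
  assumes "b > 0" "d \<ge> 0"
  obtains C where "C > 0" "\<And>\<nu>. 0 < \<nu> \<Longrightarrow> \<nu> \<le> 1 \<Longrightarrow> \<nu> powr (- d) \<le> C * sqrt \<nu> * exp (b / \<nu>)"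
proof -
  define n where "n = nat \<lceil>d\<rceil> + 1"
  have n: "n > 0" "real n \<ge> d + 1/2" using assms by (auto simp: n_def) linarith
  show ?thesis
  proof (rule that[of "(real n / b) ^ n"])
    fix \<nu> :: real assume \<nu>: "0 < \<nu>" "\<nu> \<le> 1"
    have "\<nu> powr (- d) = sqrt \<nu> * \<nu> powr (- (d + 1/2))"
      using \<nu> by (simp add: powr_half_sqrt[symmetric] powr_add[symmetric])
    also have "\<dots> \<le> sqrt \<nu> * \<nu> powr (- real n)"
      using \<nu> n by (intro mult_left_mono powr_mono') auto
    also have "\<nu> powr (- real n) = (1 / \<nu>) ^ n"
      using \<nu> by (simp add: powr_minus powr_realpow power_one_over inverse_eq_divide)
    also have "sqrt \<nu> * (1 / \<nu>) ^ n \<le> sqrt \<nu> * ((real n / b) ^ n * exp (b * (1 / \<nu>)))"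
      using \<nu> n assms by (intro mult_left_mono power_le_exp) auto
    finally show "\<nu> powr (- d) \<le> (real n / b) ^ n * sqrt \<nu> * exp (b / \<nu>)" by (simp add: mult_ac)
  qed (use n assms in auto)
qed

text \<open>The restriction \<open>\<nu> \<le> exp (- 1)\<close> makes the logarithm at least \<open>1\<close>, so that \<open>n \<le> \<nu> powr (- 1/3)\<close>.\<close>

lemma iteration_count_bound:
  fixes \<nu> C :: real
  assumes "0 < \<nu>" "\<nu> \<le> exp (- 1)" "C \<ge> 1"
    and n: "real n \<le> inverse C * (\<nu> * ln (1 / \<nu>)) powr (- 1 / 3)"
  shows "real n * sqrt \<nu> \<le> \<nu> powr (1 / 6)"
proof -
  have "ln \<nu> \<le> - 1" using assms ln_le_cancel_iff[of \<nu> "exp (- 1)"] by simp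
  then have "\<nu> * 1 \<le> \<nu> * ln (1 / \<nu>)" using assms by (intro mult_left_mono) (auto simp: ln_div)
  then have "(\<nu> * ln (1 / \<nu>)) powr (- 1 / 3) \<le> \<nu> powr (- 1 / 3)"
    using assms by (intro powr_mono2') auto
  moreover have "inverse C * (\<nu> * ln (1 / \<nu>)) powr (- 1 / 3) \<le> 1 * (\<nu> * ln (1 / \<nu>)) powr (- 1 / 3)"
    using assms by (intro mult_right_mono) (auto simp: field_simps)
  ultimately have "real n \<le> \<nu> powr (- 1 / 3)" using n by linarith
  then have "real n * sqrt \<nu> \<le> \<nu> powr (- 1 / 3) * sqrt \<nu>" using assms by (intro mult_right_mono) auto
  also have "\<dots> = \<nu> powr (1 / 6)"
    using assms by (simp add: powr_half_sqrt[symmetric] powr_add[symmetric])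
  finally show ?thesis .
qed

section \<open>The potential near its minimizers\<close>

locale weak_kam_nbhd =
  fixes F \<psi> :: "real ^ 'd::finite \<Rightarrow> real" and \<delta> :: real and U :: "(real ^ 'd) set"
  assumes potential: "admissible_potential F"
    and weak_kam: "weak_kam_solution F \<psi>"
    and \<delta>_pos: "\<delta> > 0"
    and nbhd: "admissible_nbhd F \<psi> \<delta> U"
begin

lemma F_periodic: "periodic F" and F_C3: "C3_on F UNIV"
  using potential Ck_on_3_imp[of F UNIV] unfolding admissible_potential_def Ck_per_def by auto

lemma F_continuous: "continuous_on UNIV F"
  using F_C3 C2_on_continuous unfolding C3_on_def by blast

lemma F_nonneg: "F y \<ge> 0" and F_eq_0_iff: "F y = 0 \<longleftrightarrow> y \<in> int_lattice"
proof -
  have a: "argmin F = int_lattice" "F 0 = 0" using potential unfolding admissible_potential_def by auto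
  have m: "F 0 \<le> F z" for z
    using a zero_in_int_lattice unfolding argmin_def is_arg_min_def
    by (metis (mono_tags, lifting) mem_Collect_eq not_less)
  show "F y \<ge> 0" using m[of y] a by simp
  have "y \<in> argmin F \<longleftrightarrow> F y = 0"
  proof
    assume "y \<in> argmin F"
    then have "F y \<le> F 0" unfolding argmin_def is_arg_min_def by (auto simp: not_less)
    with m[of y] a show "F y = 0" by simp
  qed (use m a in \<open>auto simp: argmin_def is_arg_min_def not_less\<close>)
  then show "F y = 0 \<longleftrightarrow> y \<in> int_lattice" using a by simp
qed

lemma hessian_F_bounded:
  obtains B where "B \<ge> 0" "\<And>x v. \<bar>v \<bullet> (hessian F x *v v)\<bar> \<le> B * (norm v)\<^sup>2"
proof -
  have "\<exists>B\<ge>0. \<forall>x. \<bar>partial_deriv i (partial_deriv j F) x\<bar> \<le> B" for i j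
  proof -
    have "continuous_on UNIV (partial_deriv i (partial_deriv j F))"
      using F_C3 unfolding C3_on_def
      by (auto intro!: continuous_at_imp_continuous_on differentiable_imp_continuous_within)
    then show ?thesis
      using periodic_continuous_bounded periodic_partial_deriv F_periodic by metis
  qed
  then obtain B where B: "\<And>i j. B i j \<ge> 0" "\<And>i j x. \<bar>partial_deriv i (partial_deriv j F) x\<bar> \<le> B i j"
    by metis
  define B0 where "B0 = Max (range (\<lambda>(i,j). B i j))"
  have B0: "B0 \<ge> B i j" for i j
    unfolding B0_def by (auto intro!: Max_ge rangeI[of "\<lambda>(i,j). B i j" "(i,j)", simplified])
  have "\<bar>hessian F x $ i $ j\<bar> \<le> B0" for x i j
    using B(2)[of i j x] B0[of i j] by (simp add: hessian_def)
  from quadratic_form_le[OF this] show ?thesis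
    using B(1) B0 by (intro that[of "B0 * real CARD('d)^2"]) (auto intro!: mult_nonneg_nonneg order_trans[OF B(1) B0])
qed

lemma hessian_F_lipschitz:
  obtains L where "L \<ge> 0"
    "\<And>x v. \<bar>v \<bullet> (hessian F x *v v) - v \<bullet> (hessian F 0 *v v)\<bar> \<le> L * lattice_dist x * (norm v)\<^sup>2"
  by (rule hessian_F_bounded, rule hessian_lipschitz_lattice_dist[OF F_periodic F_C3 UNIV_I]) auto

text \<open>Near the lattice this is Taylor's formula with the positive definite Hessian at \<open>0\<close>; away from it
  \<open>F\<close> has a positive minimum on a fundamental cell while \<^const>\<open>infdist\<close> stays bounded.\<close>

lemma F_growth:
  obtains c where "c > 0" "\<And>y. F y \<ge> c * (lattice_dist y)\<^sup>2"
proof -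
  obtain L where L: "L \<ge> 0" "\<And>x v. \<bar>v \<bullet> (hessian F x *v v) - v \<bullet> (hessian F 0 *v v)\<bar> \<le> L * lattice_dist x * (norm v)\<^sup>2"
    using hessian_F_lipschitz by blast
  obtain m where m: "m > 0" "\<And>v. m * (norm v)\<^sup>2 \<le> v \<bullet> (hessian F 0 *v v)"
    using potential pos_definite_lower_bound unfolding admissible_potential_def by blast
  define r where "r = m / (2 * (L + 1))"
  have r: "r > 0" "L * r \<le> m / 2" using m L by (auto simp: r_def field_simps)
  have near: "F v \<ge> m / 4 * (norm v)\<^sup>2" if v: "norm v \<le> r" for v
  proof -
    define g where "g t = F (0 + t *\<^sub>R v)" for t
    obtain t where t: "0 \<le> t" "t \<le> 1" "g 1 = v \<bullet> (hessian F (0 + t *\<^sub>R v) *v v) / 2"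
    proof (rule taylor2_at_minimum)
      show "(g has_real_derivative (\<Sum>i\<in>UNIV. v $ i * partial_deriv i F (0 + t *\<^sub>R v))) (at t)" for t
        unfolding g_def using F_C3 unfolding C3_on_def C2_on_def
        by (intro has_real_derivative_along_line) auto
      show "((\<lambda>t. \<Sum>i\<in>UNIV. v $ i * partial_deriv i F (0 + t *\<^sub>R v)) has_real_derivative
          v \<bullet> (hessian F (0 + t *\<^sub>R v) *v v)) (at t)" for t
        using F_C3 unfolding C3_on_def by (intro second_derivative_along_line[where S=UNIV]) auto
      show "g 0 = 0" "\<And>t. 0 \<le> g t" using F_eq_0_iff[of 0] zero_in_int_lattice F_nonneg by (auto simp: g_def)
    qed
    have "lattice_dist (0 + t *\<^sub>R v) \<le> norm (t *\<^sub>R v)" 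
      using lattice_dist_le[OF zero_in_int_lattice, of "0 + t *\<^sub>R v"] by simp
    also have "\<dots> \<le> 1 * norm v" using t by (simp only: norm_scaleR) (intro mult_right_mono, auto)
    finally have "L * lattice_dist (0 + t *\<^sub>R v) * (norm v)\<^sup>2 \<le> L * r * (norm v)\<^sup>2"
      using L v by (intro mult_right_mono mult_left_mono) auto
    also have "\<dots> \<le> m / 2 * (norm v)\<^sup>2" using r by (intro mult_right_mono) auto
    finally have "v \<bullet> (hessian F (0 + t *\<^sub>R v) *v v) \<ge> m / 2 * (norm v)\<^sup>2"
      using L(2)[of v "0 + t *\<^sub>R v"] m(2)[of v] by (auto simp: abs_le_iff)
    then show ?thesis using t(3) by (simp add: g_def)
  qed
  obtain R where R: "R > 0" "\<And>x :: real ^ 'd. lattice_dist x \<le> R" using lattice_dist_bounded by blast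
  define K :: "(real ^ 'd) set" where "K = cbox 0 1 \<inter> {x. r \<le> lattice_dist x}"
  have "compact K" unfolding K_def
    by (intro compact_Int_closed closed_Collect_le continuous_intros) auto
  have "\<exists>m'>0. \<forall>x\<in>K. m' \<le> F x"
  proof (cases "K = {}")
    case False
    obtain x where x: "x \<in> K" "\<And>y. y \<in> K \<Longrightarrow> F x \<le> F y"
      using continuous_attains_inf[OF \<open>compact K\<close> False continuous_on_subset[OF F_continuous]] by blast
    have "x \<notin> int_lattice" using x(1) r unfolding K_def by auto
    then have "F x > 0" using F_eq_0_iff F_nonneg by (metis order_le_less)
    with x show ?thesis by blast
  qed (auto intro: exI[of _ 1])
  then obtain m' where m': "m' > 0" "\<And>x. x \<in> K \<Longrightarrow> m' \<le> F x" by blast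
  show ?thesis
  proof (rule that[of "min (m / 4) (m' / R\<^sup>2)"])
    fix y
    show "F y \<ge> min (m / 4) (m' / R\<^sup>2) * (lattice_dist y)\<^sup>2"
    proof (cases "lattice_dist y < r")
      case True
      obtain k where k: "k \<in> int_lattice" "lattice_dist y = norm (y - k)" by (rule nearest_lattice_point)
      have "m / 4 * (lattice_dist y)\<^sup>2 \<le> F (y - k)" using near[of "y - k"] k True by simp
      also have "\<dots> = F y" using periodic_minus[OF F_periodic k(1)] .
      finally show ?thesis by (smt (verit) mult_right_mono zero_le_power2)
    next
      case False
      obtain k where k: "k \<in> int_lattice" "y - k \<in> cbox 0 1" by (rule lattice_reduction)
      have "y - k \<in> K"
        using k False periodic_minus[OF periodic_lattice_dist k(1)] by (simp add: K_def)
      then have "m' \<le> F y" using m'(2) periodic_minus[OF F_periodic k(1)] by fastforce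
      moreover have "m' / R\<^sup>2 * (lattice_dist y)\<^sup>2 \<le> m' / R\<^sup>2 * R\<^sup>2"
        using R m' by (intro mult_left_mono power_mono) (auto simp: infdist_nonneg)
      ultimately have "m' / R\<^sup>2 * (lattice_dist y)\<^sup>2 \<le> F y" using R by simp
      then show ?thesis by (smt (verit) mult_right_mono zero_le_power2)
    qed
  qed (use m m' R in auto)
qed

section \<open>The weak KAM solution\<close>

definition calibrated :: "real ^ 'd \<Rightarrow> real ^ 'd \<Rightarrow> bool" where
  "calibrated y x \<longleftrightarrow> \<psi> x = \<psi> y + h F y x"

abbreviation ht :: "real ^ 'd \<Rightarrow> real ^ 'd \<Rightarrow> real" where
  "ht y x \<equiv> h_tilde F \<psi> y x"

lemma \<psi>_periodic: "periodic \<psi>" and \<psi>_continuous: "continuous_on UNIV \<psi>" and \<psi>_0: "\<psi> 0 = 0"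
  using weak_kam unfolding weak_kam_solution_def Ck_per_def by auto

lemma argmin_iff_calibrated: "y \<in> argmin (\<lambda>y. h_psi F \<psi> y x) \<longleftrightarrow> calibrated y x"
  and \<psi>_le: "\<psi> x \<le> \<psi> y + h F y x"
  and calibrated_exists: "\<exists>y. calibrated y x"
proof -
  obtain z where z: "z \<in> argmin (\<lambda>y. \<psi> y + h F y x)" "\<psi> x = \<psi> z + h F z x"
    using weak_kam unfolding weak_kam_solution_def is_min_value_def by blast
  then have le: "\<psi> x \<le> \<psi> y + h F y x" for y
    unfolding argmin_def is_arg_min_def by (auto simp: not_less)
  then show "\<psi> x \<le> \<psi> y + h F y x" .
  show "\<exists>y. calibrated y x" using z(2) unfolding calibrated_def by blast
  show "y \<in> argmin (\<lambda>y. h_psi F \<psi> y x) \<longleftrightarrow> calibrated y x"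
    using le z(2) unfolding argmin_def is_arg_min_def h_psi_def calibrated_def
    by simp (metis linorder_not_less order_antisym_conv)
qed

lemma ht_nonneg: "ht y x \<ge> 0"
  using \<psi>_le[of x y] by (simp add: h_tilde_def)

lemma ht_calibrated: "calibrated y x \<Longrightarrow> ht y x = 0"
  by (simp add: calibrated_def h_tilde_def)

lemma calibrated_in_U: "calibrated y x \<Longrightarrow> y \<in> U"
  using nbhd argmin_iff_calibrated unfolding admissible_nbhd_def D_minus_def by blast

text \<open>At a minimum point \<open>m\<close> of \<open>\<psi>\<close>, passing to a calibrated point cannot decrease \<open>\<psi>\<close>, so both the kinetic
  and the potential term vanish.  Hence \<open>m\<close> is a lattice point, where \<open>\<psi>\<close> is zero.\<close>

lemma \<psi>_nonneg: "\<psi> x \<ge> 0"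
proof -
  have "\<exists>m\<in>cbox 0 1. \<forall>y\<in>cbox (0 :: real ^ 'd) 1. \<psi> m \<le> \<psi> y"
    by (rule continuous_attains_inf) (auto simp: interval_ne_empty_cart intro: continuous_on_subset[OF \<psi>_continuous])
  then obtain m where m: "\<And>y. y \<in> cbox 0 1 \<Longrightarrow> \<psi> m \<le> \<psi> y" by blast
  have min: "\<psi> m \<le> \<psi> y" for y
  proof -
    obtain k where "k \<in> int_lattice" "y - k \<in> cbox 0 1" by (rule lattice_reduction)
    then show ?thesis using m periodic_minus[OF \<psi>_periodic] by metis
  qed
  obtain y where y: "calibrated y m" using calibrated_exists by blast
  have 0: "(norm (m - y))\<^sup>2 / 2 + F y \<le> 0"
    using y min[of y] unfolding calibrated_def h_def by simp
  then have "F y = 0" using F_nonneg[of y] zero_le_power2[of "norm (m - y)"] by linarith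
  with 0 have "m = y" by simp
  with \<open>F y = 0\<close> have "m \<in> int_lattice" using F_eq_0_iff by simp
  then have "\<psi> m = 0" using \<psi>_0 \<psi>_periodic unfolding periodic_def by (metis add_0)
  then show ?thesis using min[of x] by simp
qed

lemma \<psi>_le_lattice_dist: "\<psi> x \<le> (lattice_dist x)\<^sup>2 / 2"
proof -
  obtain k where k: "k \<in> int_lattice" "lattice_dist x = norm (x - k)" by (rule nearest_lattice_point)
  have "\<psi> k = 0" "F k = 0"
    using \<psi>_0 \<psi>_periodic F_eq_0_iff k unfolding periodic_def by (metis add_0)+
  then show ?thesis using \<psi>_le[of x k] k by (simp add: h_def)
qed

lemma \<psi>_bounded: obtains B where "B > 0" "\<And>x. \<psi> x \<le> B"
proof -
  obtain B where "B \<ge> 0" "\<And>x. \<bar>\<psi> x\<bar> \<le> B"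
    using periodic_continuous_bounded[OF \<psi>_periodic \<psi>_continuous] by blast
  then show ?thesis using that[of "B + 1"] by (smt (verit))
qed

text \<open>The Lyapunov function of the backward dynamics.  Its decrease has to dominate an error that is linear in the
  lattice distance, whereas \<open>\<psi>\<close> itself is only known to decrease by a multiple of the square of that distance.\<close>

definition s :: "real ^ 'd \<Rightarrow> real" where "s x = sqrt (\<psi> x)"

lemma s_nonneg: "s x \<ge> 0" by (simp add: s_def \<psi>_nonneg)

text \<open>With \<open>w\<close> calibrated to \<open>x\<close>, the function \<open>u \<mapsto> sqrt (\<psi> w + h F w u)\<close> is the norm of an affine function of \<open>u\<close>,
  hence Lipschitz; it lies above \<open>s\<close> and touches it at \<open>x\<close>.\<close>

lemma s_lipschitz: "s y \<le> s x + norm (y - x)"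
proof -
  obtain w where w: "calibrated w x" using calibrated_exists by blast
  \<comment> \<open>\<open>N u\<close> is the Euclidean norm of the pair of \<open>p\<close> and \<open>(u - w) / sqrt 2\<close>.\<close>
  define p where "p = sqrt (\<psi> w + F w)"
  define N where "N u = norm (p, (1 / sqrt 2) *\<^sub>R (u - w))" for u
  have p2: "p\<^sup>2 = \<psi> w + F w" using \<psi>_nonneg F_nonneg by (simp add: p_def)
  have N: "N u = sqrt (\<psi> w + h F w u)" for u
    by (simp add: N_def norm_Pair p2 h_def power_mult_distrib power_divide)
  have "N y \<le> N x + norm ((0::real), (1 / sqrt 2) *\<^sub>R (y - x))"
    unfolding N_def by (rule order_trans[OF _ norm_triangle_ineq]) (simp add: algebra_simps)
  also have "norm ((0::real), (1 / sqrt 2) *\<^sub>R (y - x)) \<le> norm (y - x)"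
  proof -
    have "norm ((0::real), (1 / sqrt 2) *\<^sub>R (y - x)) = (1 / sqrt 2) * norm (y - x)"
      by (simp add: norm_Pair)
    also have "\<dots> \<le> 1 * norm (y - x)" by (rule mult_right_mono) auto
    finally show ?thesis by simp
  qed
  finally have "N y \<le> N x + norm (y - x)" by simp
  moreover have "s x = N x" using w by (simp add: N s_def calibrated_def)
  moreover have "s y \<le> N y" unfolding N s_def using \<psi>_le[of y w] by simp
  ultimately show ?thesis by simp
qed

text \<open>Calibration gives \<open>\<psi> x \<ge> \<psi> y + F y\<close> with \<open>F y \<ge> c * D\<^sup>2\<close>.  Since
  \<open>sqrt (p + c * D\<^sup>2) - sqrt p\<close> decreases in \<open>p\<close>, the worst case is the largest possible value
  of \<open>p = \<psi> y\<close>, which is \<open>D\<^sup>2 / 2\<close>; there it is a multiple of \<open>D\<close>.\<close>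

lemma s_decrease:
  obtains c where "c > 0" "\<And>x y. calibrated y x \<Longrightarrow> s y + c * lattice_dist y \<le> s x"
proof -
  obtain c where c: "c > 0" "\<And>y. F y \<ge> c * (lattice_dist y)\<^sup>2" using F_growth by blast
  \<comment> \<open>The gain \<open>sqrt (p + c * D\<^sup>2) - sqrt p\<close> at \<open>p = D\<^sup>2 / 2\<close>, divided by \<open>D\<close>.\<close>
  define c' where "c' = sqrt (1/2 + c) - sqrt (1/2)"
  have "c' > 0" using c by (simp add: c'_def)
  moreover have "s y + c' * lattice_dist y \<le> s x" if "calibrated y x" for x y
  proof (cases "lattice_dist y = 0")
    case True
    have "\<psi> y \<le> \<psi> x" using that F_nonneg[of y] by (simp add: calibrated_def h_def)
    with True show ?thesis by (simp add: s_def)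
  next
    case False
    define D where "D = lattice_dist y"
    have D: "D > 0" using False infdist_nonneg[of y] by (simp add: D_def order_less_le)
    define a b where "a = s y" and "b = sqrt (\<psi> y + c * D\<^sup>2)"
    have a2: "a\<^sup>2 = \<psi> y" "a \<ge> 0" using \<psi>_nonneg by (auto simp: a_def s_def)
    have b2: "b\<^sup>2 = \<psi> y + c * D\<^sup>2" "b \<ge> 0" using \<psi>_nonneg c by (auto simp: b_def)
    have "b \<le> s x"
      unfolding b_def s_def using that add_increasing[OF zero_le_power2[of "norm (x - y)"], of "c * D\<^sup>2" "F y"] c(2)[of y]
      by (simp add: calibrated_def h_def D_def add_increasing)
    have aD: "a \<le> sqrt (1/2) * D"
    proof -
      have "a \<le> sqrt (1/2 * D\<^sup>2)"
        unfolding a_def s_def D_def using \<psi>_le_lattice_dist[of y] by (intro real_sqrt_le_mono) simp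
      also have "\<dots> = sqrt (1/2) * D" using D by (simp only: real_sqrt_mult real_sqrt_abs abs_of_pos)
      finally show ?thesis .
    qed
    have "\<psi> y + c * D\<^sup>2 \<le> (1/2 + c) * D\<^sup>2" using \<psi>_le_lattice_dist[of y] by (simp add: D_def algebra_simps)
    then have "b \<le> sqrt ((1/2 + c) * D\<^sup>2)" unfolding b_def by (rule real_sqrt_le_mono)
    also have "\<dots> = sqrt (1/2 + c) * D" using D by (simp only: real_sqrt_mult real_sqrt_abs abs_of_pos)
    finally have bD: "b \<le> sqrt (1/2 + c) * D" .
    have bp: "b > 0" using b2 c D \<psi>_nonneg[of y] unfolding b_def by (simp add: add_nonneg_pos)
    have "c' * D * (b + a) \<le> c' * D * ((sqrt (1/2 + c) + sqrt (1/2)) * D)"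
      using aD bD \<open>c' > 0\<close> D by (intro mult_left_mono) (auto simp: algebra_simps)
    also have "\<dots> = ((sqrt (1/2 + c))\<^sup>2 - (sqrt (1/2))\<^sup>2) * D\<^sup>2"
      by (simp only: c'_def) (simp only: power2_eq_square algebra_simps)
    also have "\<dots> = c * D\<^sup>2" using c by simp
    also have "\<dots> = (b - a) * (b + a)" using a2 b2 by (simp add: power2_eq_square algebra_simps)
    finally have "c' * D \<le> b - a" using bp a2 by (simp add: mult_le_cancel_right)
    with \<open>b \<le> s x\<close> show ?thesis by (simp add: a_def D_def)
  qed
  ultimately show ?thesis using that by blast
qed

lemma s_bounded: obtains S where "S > 0" "\<And>x. s x \<le> S"
proof -
  obtain B where "B > 0" "\<And>x. \<psi> x \<le> B" using \<psi>_bounded by blast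
  then show ?thesis using that[of "sqrt B"] by (simp add: s_def)
qed

text \<open>\<open>\<psi>\<close> is semiconcave: it lies below \<open>\<psi> w + h F w \<cdot>\<close> for \<open>w\<close> calibrated to \<open>y\<close>, with equality at \<open>y\<close>.
  Replacing \<open>\<psi>\<close> by this smooth majorant gives a function \<open>g\<close> with bounded second derivative that is
  nonnegative and vanishes at \<open>y\<close>.\<close>

lemma ht_upper_quadratic:
  obtains C where "C > 0" "\<And>x y z. calibrated y x \<Longrightarrow> ht z x \<le> C * (norm (z - y))\<^sup>2"
proof -
  obtain B where B: "B \<ge> 0" "\<And>x v. \<bar>v \<bullet> (hessian F x *v v)\<bar> \<le> B * (norm v)\<^sup>2" using hessian_F_bounded by blast
  have "ht z x \<le> (B / 2 + 1) * (norm (z - y))\<^sup>2" if cal: "calibrated y x" for x y z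
  proof -
    define v where "v = z - y"
    obtain w where w: "calibrated w y" using calibrated_exists by blast
    define g where "g t = F (y + t *\<^sub>R v) + (norm (y - x + t *\<^sub>R v))\<^sup>2 / 2 + (norm (y - w + t *\<^sub>R v))\<^sup>2 / 2
        + (\<psi> w + F w - \<psi> x)" for t
    have ge: "ht (y + t *\<^sub>R v) x \<le> g t" for t
      using \<psi>_le[of "y + t *\<^sub>R v" w] unfolding g_def h_tilde_def h_def
      by (simp add: norm_minus_commute[of x] algebra_simps)
    obtain t where t: "0 \<le> t" "t \<le> 1"
      "g 1 = (v \<bullet> (hessian F (y + t *\<^sub>R v) *v v) + (norm v)\<^sup>2 + (norm v)\<^sup>2 + 0) / 2"
    proof (rule taylor2_at_minimum)
      show "(g has_real_derivative (\<Sum>i\<in>UNIV. v $ i * partial_deriv i F (y + t *\<^sub>R v))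
         + (y - x + t *\<^sub>R v) \<bullet> v + (y - w + t *\<^sub>R v) \<bullet> v + 0) (at t)" for t
        unfolding g_def
        by (intro DERIV_add DERIV_const half_norm_square_derivatives has_real_derivative_along_line)
          (use F_C3 in \<open>simp add: C3_on_def C2_on_def\<close>)
      show "((\<lambda>t. (\<Sum>i\<in>UNIV. v $ i * partial_deriv i F (y + t *\<^sub>R v))
         + (y - x + t *\<^sub>R v) \<bullet> v + (y - w + t *\<^sub>R v) \<bullet> v + 0) has_real_derivative
          v \<bullet> (hessian F (y + t *\<^sub>R v) *v v) + (norm v)\<^sup>2 + (norm v)\<^sup>2 + 0) (at t)" for t
        by (intro DERIV_add DERIV_const half_norm_square_derivatives second_derivative_along_line[where S=UNIV])
          (use F_C3 in \<open>simp_all add: C3_on_def\<close>)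
      show "\<And>t. 0 \<le> g t" using ge ht_nonneg order_trans by blast
      show "g 0 = 0" using cal w
        by (simp add: g_def calibrated_def h_def norm_minus_commute[of x])
    qed
    have "ht z x \<le> g 1" using ge[of 1] by (simp add: v_def)
    also have "\<dots> \<le> (B / 2 + 1) * (norm v)\<^sup>2"
      using t(3) B(2)[of v "y + t *\<^sub>R v"] by (simp add: algebra_simps)
    finally show ?thesis by (simp add: v_def)
  qed
  with B show ?thesis by (intro that[of "B / 2 + 1"]) auto
qed

lemma ht_outside: "z \<notin> U \<Longrightarrow> ht z x \<ge> \<delta>"
proof -
  assume z: "z \<notin> U"
  obtain y where y: "calibrated y x" using calibrated_exists by blast
  have "(INF z. h_psi F \<psi> z x) = \<psi> x"
  proof (rule cInf_eq_minimum)
    show "\<psi> x \<in> range (\<lambda>z. h_psi F \<psi> z x)" using y by (auto simp: h_psi_def calibrated_def)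
  qed (use \<psi>_le in \<open>auto simp: h_psi_def\<close>)
  moreover have "h_psi F \<psi> z x - (INF z. h_psi F \<psi> z x) \<ge> \<delta>"
    using nbhd z unfolding admissible_nbhd_def by blast
  ultimately show ?thesis by (simp add: h_tilde_def h_psi_def)
qed

text \<open>The quadratic upper bound keeps \<open>h_tilde\<close> below \<open>\<delta>\<close> on a ball of uniform radius, whereas it is at least \<open>\<delta>\<close>
  off \<open>U\<close>.\<close>

lemma calibrated_ball_in_U:
  obtains r where "r > 0" "\<And>x y. calibrated y x \<Longrightarrow> ball y r \<subseteq> U"
proof -
  obtain C where C: "C > 0" "\<And>x y z. calibrated y x \<Longrightarrow> ht z x \<le> C * (norm (z - y))\<^sup>2"
    using ht_upper_quadratic by blast
  define r where "r = sqrt (\<delta> / C)"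
  have "ball y r \<subseteq> U" if "calibrated y x" for x y
  proof
    fix z assume "z \<in> ball y r"
    then have "norm (z - y) < r" by (simp add: dist_norm norm_minus_commute)
    then have "(norm (z - y))\<^sup>2 < r\<^sup>2" by (intro power_strict_mono) auto
    then have "C * (norm (z - y))\<^sup>2 < C * (\<delta> / C)"
      using C(1) \<delta>_pos by (intro mult_strict_left_mono) (auto simp: r_def)
    then have "ht z x < \<delta>" using C(2)[OF that, of z] C(1) by simp
    then show "z \<in> U" using ht_outside[of z x] by linarith
  qed
  then show ?thesis using that[of r] C \<delta>_pos by (auto simp: r_def)
qed

text \<open>Inserting the minimizer \<open>y\<close> into the nondegeneracy hypothesis shows that it coincides with
  \<^const>\<open>ybar\<close>.\<close>

lemma ht_lower_quadratic:
  assumes "x \<in> U" "calibrated y x"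
  shows "ht z x \<ge> \<delta> * (norm (z - y))\<^sup>2"
proof -
  let ?b = "ybar F \<psi> x"
  have *: "h_psi F \<psi> z x - h_psi F \<psi> ?b x \<ge> \<delta> * (norm (z - ?b))\<^sup>2" for z
    using nbhd assms(1) unfolding admissible_nbhd_def by blast
  have y: "h_psi F \<psi> y x = \<psi> x" using assms by (simp add: h_psi_def calibrated_def)
  have "\<delta> * (norm (y - ?b))\<^sup>2 \<le> 0"
    using *[of y] y \<psi>_le[of x ?b] by (simp add: h_psi_def)
  then have "?b = y" using \<delta>_pos by (auto simp: mult_le_0_iff)
  then show ?thesis using *[of z] y by (simp add: h_tilde_def h_psi_def)
qed

text \<open>The second-order Taylor polynomial of \<open>h_tilde F \<psi> \<cdot> 0\<close> at \<open>0\<close>.\<close>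

definition q :: "real ^ 'd \<Rightarrow> real" where
  "q v = (v \<bullet> (hessian \<psi> 0 *v v) + v \<bullet> (hessian F 0 *v v) + (norm v)\<^sup>2) / 2"

lemma q_scale: "q (t *\<^sub>R v) = t\<^sup>2 * q v"
  by (simp add: q_def matrix_vector_mult_scaleR power2_eq_square algebra_simps)

lemma q_continuous: "continuous_on UNIV q"
  unfolding q_def[abs_def]
  by (intro continuous_intros linear_continuous_on matrix_vector_mul_bounded_linear) auto

lemma calibrated_0: "calibrated 0 0"
  using F_eq_0_iff zero_in_int_lattice by (simp add: calibrated_def h_def)

text \<open>For small \<open>v\<close> the segment from \<open>y\<close> to \<open>y + v\<close> stays in \<open>U\<close>, so Taylor's formula expresses the energy through
  the Hessian at an intermediate point, whose lattice distance is at most \<open>norm v + lattice_dist y\<close>.  For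
  \<open>norm v \<ge> r\<close> both terms are \<open>O((norm v)\<^sup>2)\<close>, hence \<open>O((norm v) ^ 3)\<close>.\<close>

lemma ht_approx_q:
  obtains C where "C > 0" "\<And>x y v. calibrated y x \<Longrightarrow>
      \<bar>ht (y + v) x - q v\<bar> \<le> C * (norm v + lattice_dist y) * (norm v)\<^sup>2"
proof -
  obtain B where B: "\<And>x v. \<bar>v \<bullet> (hessian F x *v v)\<bar> \<le> B * (norm v)\<^sup>2" using hessian_F_bounded by blast
  obtain L where L: "L \<ge> 0" "\<And>x v. \<bar>v \<bullet> (hessian F x *v v) - v \<bullet> (hessian F 0 *v v)\<bar> \<le> L * lattice_dist x * (norm v)\<^sup>2"
    using hessian_F_lipschitz by blast
  have zU: "0 \<in> U" using calibrated_0 calibrated_in_U by blast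
  have C3: "C3_on \<psi> U" using nbhd Ck_on_3_imp unfolding admissible_nbhd_def by blast
  obtain b where b: "\<And>x. x \<in> U \<Longrightarrow> norm (hessian \<psi> x) \<le> b"
  proof -
    have "bounded (hessian \<psi> ` U)" using nbhd unfolding admissible_nbhd_def by blast
    then show ?thesis using that unfolding bounded_iff by blast
  qed
  have B': "\<bar>v \<bullet> (hessian \<psi> x *v v)\<bar> \<le> b * real CARD('d)^2 * (norm v)\<^sup>2" if "x \<in> U" for x v
    
  proof (rule quadratic_form_le)
    fix i j
    have "\<bar>hessian \<psi> x $ i $ j\<bar> \<le> norm (hessian \<psi> x $ i)" by (rule component_le_norm_cart)
    also have "\<dots> \<le> norm (hessian \<psi> x)" by (rule Finite_Cartesian_Product.norm_nth_le)
    finally show "\<bar>hessian \<psi> x $ i $ j\<bar> \<le> b" using b[OF that] by simp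
  qed
  obtain M where M: "M \<ge> 0" "\<And>x v. x \<in> U \<Longrightarrow> \<bar>v \<bullet> (hessian \<psi> x *v v) - v \<bullet> (hessian \<psi> 0 *v v)\<bar> \<le> M * lattice_dist x * (norm v)\<^sup>2"
    by (rule hessian_lipschitz_lattice_dist[OF \<psi>_periodic C3 zU B']) (auto intro: that)
  obtain C where C: "C > 0" "\<And>x y z. calibrated y x \<Longrightarrow> ht z x \<le> C * (norm (z - y))\<^sup>2"
    using ht_upper_quadratic by blast
  obtain r where r: "r > 0" "\<And>x y. calibrated y x \<Longrightarrow> ball y r \<subseteq> U" using calibrated_ball_in_U by blast
  define Q where "Q = B + b * real CARD('d)^2 + 1"
  have q: "\<bar>q v\<bar> \<le> Q * (norm v)\<^sup>2" for v
  proof -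
    have "2 * q v = v \<bullet> (hessian \<psi> 0 *v v) + v \<bullet> (hessian F 0 *v v) + (norm v)\<^sup>2"
      by (simp add: q_def)
    then show ?thesis
      using B[of v 0] B'[OF zU, of v] zero_le_power2[of "norm v"]
      unfolding Q_def distrib_right abs_le_iff mult_1 by linarith
  qed
  have "0 \<le> Q * (norm (axis undefined 1 :: real ^ 'd))\<^sup>2" using q abs_ge_zero order_trans by blast
  then have "Q \<ge> 0" by (simp add: norm_axis_1)
  define C1 where "C1 = max (L + M) ((C + Q) / r)"
  have "C1 > 0" unfolding C1_def using C r \<open>Q \<ge> 0\<close> by (simp add: less_max_iff_disj)
  have "\<bar>ht (y + v) x - q v\<bar> \<le> C1 * (norm v + lattice_dist y) * (norm v)\<^sup>2" if cal: "calibrated y x" for x y v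
  proof (cases "norm v < r")
    case True
    define g where "g t = \<psi> (y + t *\<^sub>R v) + F (y + t *\<^sub>R v) + (norm (y - x + t *\<^sub>R v))\<^sup>2 / 2 + - \<psi> x" for t
    have ge: "ht (y + t *\<^sub>R v) x = g t" for t
      unfolding g_def h_tilde_def h_def by (simp add: norm_minus_commute[of x] algebra_simps)
    have seg: "y + t *\<^sub>R v \<in> U" "norm (t *\<^sub>R v) \<le> norm v" if "0 \<le> t" "t \<le> 1" for t
    proof -
      show le: "norm (t *\<^sub>R v) \<le> norm v" using that by (simp add: mult_left_le_one_le)
      then have "y + t *\<^sub>R v \<in> ball y r" using True by (simp add: dist_norm)
      then show "y + t *\<^sub>R v \<in> U" using r(2)[OF cal] by blast
    qed
    obtain t where t: "0 \<le> t" "t \<le> 1"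
      "g 1 = (v \<bullet> (hessian \<psi> (y + t *\<^sub>R v) *v v) + v \<bullet> (hessian F (y + t *\<^sub>R v) *v v) + (norm v)\<^sup>2 + 0) / 2"
    proof (rule taylor2_at_minimum)
      fix t :: real assume t: "0 \<le> t" "t \<le> 1"
      show "(g has_real_derivative (\<Sum>i\<in>UNIV. v $ i * partial_deriv i \<psi> (y + t *\<^sub>R v)) 
          + (\<Sum>i\<in>UNIV. v $ i * partial_deriv i F (y + t *\<^sub>R v))
         + (y - x + t *\<^sub>R v) \<bullet> v + 0) (at t)"
        unfolding g_def
        by (intro DERIV_add DERIV_const half_norm_square_derivatives has_real_derivative_along_line)
          (use F_C3 C3 seg[OF t] in \<open>simp_all add: C3_on_def C2_on_def\<close>)
      show "((\<lambda>t. (\<Sum>i\<in>UNIV. v $ i * partial_deriv i \<psi> (y + t *\<^sub>R v)) 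
          + (\<Sum>i\<in>UNIV. v $ i * partial_deriv i F (y + t *\<^sub>R v))
         + (y - x + t *\<^sub>R v) \<bullet> v + 0) has_real_derivative
          v \<bullet> (hessian \<psi> (y + t *\<^sub>R v) *v v) + v \<bullet> (hessian F (y + t *\<^sub>R v) *v v) + (norm v)\<^sup>2 + 0) (at t)"
        by (intro DERIV_add DERIV_const half_norm_square_derivatives
            second_derivative_along_line[where S=UNIV] second_derivative_along_line[where S=U])
          (use F_C3 C3 seg[OF t] in \<open>simp_all add: C3_on_def\<close>)
    next
      show "\<And>t. 0 \<le> g t" using ge ht_nonneg by metis
      show "g 0 = 0" using ge[of 0] ht_calibrated[OF cal] by simp
    qed
    define \<xi> where "\<xi> = y + t *\<^sub>R v"
    have \<xi>: "\<xi> \<in> U" "lattice_dist \<xi> \<le> norm v + lattice_dist y"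
      using seg[OF t(1,2)] lattice_dist_add[of y "t *\<^sub>R v"] by (auto simp: \<xi>_def)
    have "2 * (g 1 - q v) = (v \<bullet> (hessian F \<xi> *v v) - v \<bullet> (hessian F 0 *v v))
        + (v \<bullet> (hessian \<psi> \<xi> *v v) - v \<bullet> (hessian \<psi> 0 *v v))"
      using t(3) by (simp add: q_def \<xi>_def add_divide_distrib algebra_simps)
    then have two: "2 * \<bar>g 1 - q v\<bar> \<le> \<bar>v \<bullet> (hessian F \<xi> *v v) - v \<bullet> (hessian F 0 *v v)\<bar>
        + \<bar>v \<bullet> (hessian \<psi> \<xi> *v v) - v \<bullet> (hessian \<psi> 0 *v v)\<bar>" by linarith
    have "\<bar>g 1 - q v\<bar> \<le> 2 * \<bar>g 1 - q v\<bar>" by simp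
    also have "\<dots> \<le> \<bar>v \<bullet> (hessian F \<xi> *v v) - v \<bullet> (hessian F 0 *v v)\<bar>
        + \<bar>v \<bullet> (hessian \<psi> \<xi> *v v) - v \<bullet> (hessian \<psi> 0 *v v)\<bar>" by (rule two)
    also have "\<dots> \<le> L * lattice_dist \<xi> * (norm v)\<^sup>2 + M * lattice_dist \<xi> * (norm v)\<^sup>2"
      by (intro add_mono L M \<xi>)
    also have "\<dots> = (L + M) * lattice_dist \<xi> * (norm v)\<^sup>2" by (simp add: distrib_right)
    also have "\<dots> \<le> C1 * (norm v + lattice_dist y) * (norm v)\<^sup>2"
      using \<xi>(2) L(1) M(1) \<open>C1 > 0\<close> by (intro mult_right_mono mult_mono) (auto simp: C1_def infdist_nonneg)
    finally show ?thesis using ge[of 1] by simp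
  next
    case False
    have "\<bar>ht (y + v) x - q v\<bar> \<le> (C + Q) * (norm v)\<^sup>2"
      using C(2)[OF cal, of "y + v"] q[of v] ht_nonneg[of "y + v" x] by (simp add: algebra_simps)
    also have "\<dots> = (C + Q) / r * r * (norm v)\<^sup>2" using r by simp
    also have "\<dots> \<le> C1 * (norm v + lattice_dist y) * (norm v)\<^sup>2"
      using False C r \<open>C1 > 0\<close> \<open>Q \<ge> 0\<close> infdist_nonneg[of y]
      by (intro mult_right_mono mult_mono) (auto simp: C1_def add_increasing2)
    finally show ?thesis .
  qed
  with \<open>C1 > 0\<close> show ?thesis using that by blast
qed

text \<open>The form \<open>q\<close> inherits the quadratic lower bound of \<open>h_tilde\<close> at \<open>0\<close>: evaluate at \<open>t *\<^sub>R v\<close>,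
  divide by \<open>t\<^sup>2\<close> and let \<open>t\<close> tend to \<open>0\<close>.\<close>

lemma q_lower: "q v \<ge> \<delta> * (norm v)\<^sup>2"
proof -
  obtain C where C: "C > 0" "\<And>x y v. calibrated y x \<Longrightarrow>
      \<bar>ht (y + v) x - q v\<bar> \<le> C * (norm v + lattice_dist y) * (norm v)\<^sup>2" using ht_approx_q by blast
  have D0: "lattice_dist (0 :: real ^ 'd) = 0" by (rule infdist_zero[OF zero_in_int_lattice])
  have ev: "\<delta> * (norm v)\<^sup>2 - C * norm v * (norm v)\<^sup>2 * t \<le> q v" if t: "t > 0" for t
  proof -
    have "\<delta> * (norm (t *\<^sub>R v))\<^sup>2 \<le> ht (0 + t *\<^sub>R v) 0"
      using ht_lower_quadratic[of 0 0 "t *\<^sub>R v"] calibrated_0 calibrated_in_U by auto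
    also have "\<dots> \<le> q (t *\<^sub>R v) + C * norm (t *\<^sub>R v) * (norm (t *\<^sub>R v))\<^sup>2"
      using C(2)[OF calibrated_0, of "t *\<^sub>R v"] D0 by simp
    finally have "t\<^sup>2 * (\<delta> * (norm v)\<^sup>2) \<le> t\<^sup>2 * (q v + C * norm v * (norm v)\<^sup>2 * t)"
      using t by (simp add: q_scale power_mult_distrib algebra_simps)
    then have "\<delta> * (norm v)\<^sup>2 \<le> q v + C * norm v * (norm v)\<^sup>2 * t"
      using t by (subst (asm) mult_le_cancel_left_pos) auto
    then show ?thesis by simp
  qed
  have lim: "((\<lambda>t. \<delta> * (norm v)\<^sup>2 - C * norm v * (norm v)\<^sup>2 * t) \<longlongrightarrow> \<delta> * (norm v)\<^sup>2 - C * norm v * (norm v)\<^sup>2 * 0) (at_right 0)"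
    by (intro tendsto_intros)
  have "\<delta> * (norm v)\<^sup>2 - C * norm v * (norm v)\<^sup>2 * 0 \<le> q v"
    by (rule tendsto_upperbound[OF lim]) (auto simp: eventually_at_right_less ev intro!: eventually_at_rightI[of 0 1])
  then show ?thesis by simp
qed

section \<open>The transfer operator on bounded measurable functions\<close>

abbreviation L :: "real \<Rightarrow> (real ^ 'd \<Rightarrow> real) \<Rightarrow> real ^ 'd \<Rightarrow> real" where
  "L \<nu> \<equiv> L_tilde F \<psi> \<nu>"

definition gauss_const :: real where "gauss_const = (4 * pi) powr (- (real CARD('d) / 2))"

lemma gauss_const_pos: "gauss_const > 0" by (simp add: gauss_const_def)

lemma F_measurable[measurable]: "F \<in> borel_measurable borel"
  and \<psi>_measurable[measurable]: "\<psi> \<in> borel_measurable borel"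
  and q_measurable[measurable]: "q \<in> borel_measurable borel"
  and U_measurable[measurable]: "U \<in> sets borel"
  using F_continuous \<psi>_continuous q_continuous nbhd
  unfolding admissible_nbhd_def by (auto intro: borel_measurable_continuous_onI)

lemma s_measurable[measurable]: "s \<in> borel_measurable borel"
  unfolding s_def[abs_def] by measurable

lemma K_measurable[measurable]:
  "(\<lambda>(x, y). K_tilde F \<psi> \<nu> y x) \<in> borel_measurable (borel \<Otimes>\<^sub>M borel)"
  unfolding K_tilde_def h_tilde_def h_def by measurable

lemma ht_measurable[measurable]: "(\<lambda>y. ht y x) \<in> borel_measurable borel"
  unfolding h_tilde_def h_def by measurable

lemma K_measurable1[measurable]: "(\<lambda>y. K_tilde F \<psi> \<nu> y x) \<in> borel_measurable borel"
  unfolding K_tilde_def by measurable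

text \<open>A class of functions that the operator preserves and on which its integral converges, so that it is
  monotone there; the Bochner integral of a non-integrable function would be zero.\<close>

definition bounded_measurable :: "(real ^ 'd \<Rightarrow> real) \<Rightarrow> bool" where
  "bounded_measurable u \<longleftrightarrow> u \<in> borel_measurable borel \<and> (\<exists>b. \<forall>x. 0 \<le> u x \<and> u x \<le> b)"

lemma ht_lower_global:
  obtains B where "B > 0" "\<And>x y. ht y x \<ge> (norm (x - y))\<^sup>2 / 2 - B"
proof -
  obtain B where B: "B > 0" "\<And>x. \<psi> x \<le> B" using \<psi>_bounded by blast
  have "ht y x \<ge> (norm (x - y))\<^sup>2 / 2 - B" for x y
    using B(2)[of x] \<psi>_nonneg[of y] F_nonneg[of y] by (simp add: h_tilde_def h_def)
  with B that show ?thesis by blast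
qed

lemma integrable_exp_dist:
  assumes "a > 0"
  shows "integrable lborel (\<lambda>y :: real ^ 'd. exp (- a * (norm (x - y))\<^sup>2))"
    and "(LINT y|lborel. exp (- a * (norm (x - y))\<^sup>2)) = (LINT y|lborel. exp (- a * (norm (y :: real ^ 'd))\<^sup>2))"
  using lborel_integrable_affine_iff[of "-1" "\<lambda>y. exp (- a * (norm y)\<^sup>2)" x]
    lborel_integral_affine[of "-1" "\<lambda>y. exp (- a * (norm y)\<^sup>2)" x] integrable_gaussian[OF assms]
  by auto

lemma K_eq: "\<nu> > 0 \<Longrightarrow> K_tilde F \<psi> \<nu> y x = gauss_const * \<nu> powr (- (real CARD('d) / 2)) * exp (- ht y x / (2 * \<nu>))"
  by (simp add: K_tilde_def gauss_const_def powr_mult)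

lemma K_upper:
  assumes "\<nu> > 0"
  obtains A where "A > 0" "\<And>x y. K_tilde F \<psi> \<nu> y x \<le> A * exp (- (1 / (4 * \<nu>)) * (norm (x - y))\<^sup>2)"
proof -
  obtain B where B: "B > 0" "\<And>x y. ht y x \<ge> (norm (x - y))\<^sup>2 / 2 - B" using ht_lower_global by blast
  define A where "A = gauss_const * \<nu> powr (- (real CARD('d) / 2)) * exp (B / (2 * \<nu>))"
  have "K_tilde F \<psi> \<nu> y x \<le> A * exp (- (1 / (4 * \<nu>)) * (norm (x - y))\<^sup>2)" for x y
  proof -
    have "- ht y x / (2 * \<nu>) \<le> (B - (norm (x - y))\<^sup>2 / 2) / (2 * \<nu>)"
      using B(2)[of x y] assms by (intro divide_right_mono) auto
    also have "\<dots> = B / (2 * \<nu>) + - (1 / (4 * \<nu>)) * (norm (x - y))\<^sup>2"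
      using assms by (simp add: field_simps)
    finally have "exp (- ht y x / (2 * \<nu>)) \<le> exp (B / (2 * \<nu>) + - (1 / (4 * \<nu>)) * (norm (x - y))\<^sup>2)"
      by simp
    then show ?thesis
      unfolding K_eq[OF assms] A_def exp_add mult.assoc using assms gauss_const_pos by simp
  qed
  moreover have "A > 0" using gauss_const_pos assms by (simp add: A_def)
  ultimately show ?thesis using that by blast
qed

lemma K_nonneg: "K_tilde F \<psi> \<nu> y x \<ge> 0"
  by (simp add: K_tilde_def)

lemma kernel_times_bounded_le_gaussian:
  assumes "\<nu> > 0" "bounded_measurable u"
  obtains b where "b \<ge> 0"
    "\<And>x y. norm (K_tilde F \<psi> \<nu> y x * u y) \<le> b * exp (- (1 / (4 * \<nu>)) * (norm (x - y))\<^sup>2)"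
proof -
  obtain A where A: "A > 0" "\<And>x y. K_tilde F \<psi> \<nu> y x \<le> A * exp (- (1 / (4 * \<nu>)) * (norm (x - y))\<^sup>2)"
    using K_upper[OF assms(1)] by blast
  obtain b where b: "\<And>x. 0 \<le> u x" "\<And>x. u x \<le> b" using assms(2) unfolding bounded_measurable_def by blast
  have "b \<ge> 0" using b order_trans by blast
  have "norm (K_tilde F \<psi> \<nu> y x * u y) \<le> A * b * exp (- (1 / (4 * \<nu>)) * (norm (x - y))\<^sup>2)" for x y
  proof -
    have "norm (K_tilde F \<psi> \<nu> y x * u y) = K_tilde F \<psi> \<nu> y x * u y"
      using K_nonneg b by simp
    also have "\<dots> \<le> A * exp (- (1 / (4 * \<nu>)) * (norm (x - y))\<^sup>2) * b"
      using A b by (intro mult_mono) auto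
    finally show ?thesis by (simp add: mult_ac)
  qed
  with A \<open>b \<ge> 0\<close> show ?thesis by (intro that[of "A * b"]) auto
qed

lemma kernel_integrable:
  assumes "\<nu> > 0" "bounded_measurable u"
  shows "integrable lborel (\<lambda>y. K_tilde F \<psi> \<nu> y x * u y)"
proof -
  obtain b where b: "b \<ge> 0" "\<And>x y. norm (K_tilde F \<psi> \<nu> y x * u y) \<le> b * exp (- (1 / (4 * \<nu>)) * (norm (x - y))\<^sup>2)"
    using kernel_times_bounded_le_gaussian[OF assms] by blast
  have [measurable]: "u \<in> borel_measurable borel" using assms by (simp add: bounded_measurable_def)
  show ?thesis
  proof (rule Bochner_Integration.integrable_bound)
    show "integrable lborel (\<lambda>y. b * exp (- (1 / (4 * \<nu>)) * (norm (x - y))\<^sup>2))"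
      using assms by (intro integrable_mult_right integrable_exp_dist) auto
    show "AE y in lborel. norm (K_tilde F \<psi> \<nu> y x * u y) \<le> norm (b * exp (- (1 / (4 * \<nu>)) * (norm (x - y))\<^sup>2))"
      using order_trans[OF b(2) abs_ge_self] by auto
  qed measurable
qed

lemma bounded_measurable_L:
  assumes "\<nu> > 0" "bounded_measurable u"
  shows "bounded_measurable (L \<nu> u)"
proof -
  obtain b where b: "b \<ge> 0" "\<And>x y. norm (K_tilde F \<psi> \<nu> y x * u y) \<le> b * exp (- (1 / (4 * \<nu>)) * (norm (x - y))\<^sup>2)"
    using kernel_times_bounded_le_gaussian[OF assms] by blast
  have [measurable]: "u \<in> borel_measurable borel" using assms by (simp add: bounded_measurable_def)
  have "L \<nu> u x \<le> b * (LINT y|lborel. exp (- (1 / (4 * \<nu>)) * (norm (y :: real ^ 'd))\<^sup>2))" for x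
  proof -
    have "L \<nu> u x \<le> (LINT y|lborel. b * exp (- (1 / (4 * \<nu>)) * (norm (x - y))\<^sup>2))"
      unfolding L_tilde_def
      using b(2)[of _ x] kernel_integrable[OF assms] assms(1)
      by (intro integral_mono integrable_mult_right integrable_exp_dist) (auto simp: abs_le_iff)
    then show ?thesis using integrable_exp_dist(2)[of "1 / (4 * \<nu>)" x] assms(1) by simp
  qed
  moreover have "L \<nu> u x \<ge> 0" for x
    unfolding L_tilde_def using assms(2) K_nonneg by (auto simp: bounded_measurable_def intro!: Bochner_Integration.integral_nonneg)
  moreover have "L \<nu> u \<in> borel_measurable borel"
    unfolding L_tilde_def[abs_def] by measurable
  ultimately show ?thesis unfolding bounded_measurable_def by blast
qed

lemma L_mono:
  assumes "\<nu> > 0" "bounded_measurable u" "bounded_measurable v" "\<And>x. u x \<le> v x"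
  shows "L \<nu> u x \<le> L \<nu> v x"
  unfolding L_tilde_def
  using assms K_nonneg by (intro integral_mono kernel_integrable mult_left_mono) auto

lemma L_scale: "L \<nu> (\<lambda>x. c * u x) x = c * L \<nu> u x"
  unfolding L_tilde_def by (simp add: mult.left_commute)

text \<open>Substituting \<open>y = a + sqrt \<nu> w\<close> removes the power of \<open>\<nu>\<close> from the normalization.\<close>

lemma
  assumes "\<nu> > 0" "bounded_measurable u"
  shows L_rescaled: "L \<nu> u x = gauss_const * (LINT w|lborel. exp (- (ht (a + sqrt \<nu> *\<^sub>R w) x / (2 * \<nu>))) * u (a + sqrt \<nu> *\<^sub>R w))"
    and rescaled_integrable: "integrable lborel (\<lambda>w. exp (- (ht (a + sqrt \<nu> *\<^sub>R w) x / (2 * \<nu>))) * u (a + sqrt \<nu> *\<^sub>R w))"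
proof -
  have [measurable]: "u \<in> borel_measurable borel" using assms by (simp add: bounded_measurable_def)
  have nz: "sqrt \<nu> \<noteq> 0" using assms by simp
  have m: "(\<lambda>y. exp (- (ht y x / (2 * \<nu>))) * u y) \<in> borel_measurable borel" by measurable
  have sc: "\<nu> powr (- (real CARD('d) / 2)) * sqrt \<nu> ^ CARD('d) = 1"
    using assms by (simp add: powr_half_sqrt[symmetric] powr_realpow[symmetric] powr_powr powr_add[symmetric])
  have "L \<nu> u x = gauss_const * \<nu> powr (- (real CARD('d) / 2)) * (LINT y|lborel. exp (- (ht y x / (2 * \<nu>))) * u y)"
    unfolding L_tilde_def K_eq[OF assms(1)] by (simp add: mult.assoc)
  also have "\<dots> = gauss_const * (\<nu> powr (- (real CARD('d) / 2)) * sqrt \<nu> ^ CARD('d)) * (LINT w|lborel. exp (- (ht (a + sqrt \<nu> *\<^sub>R w) x / (2 * \<nu>))) * u (a + sqrt \<nu> *\<^sub>R w))"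
    using lborel_integral_affine[OF nz m, of a] assms(1) by simp
  finally show "L \<nu> u x = gauss_const * (LINT w|lborel. exp (- (ht (a + sqrt \<nu> *\<^sub>R w) x / (2 * \<nu>))) * u (a + sqrt \<nu> *\<^sub>R w))"
    unfolding sc by simp
  have "integrable lborel (\<lambda>y. (gauss_const * \<nu> powr (- (real CARD('d) / 2))) * (exp (- (ht y x / (2 * \<nu>))) * u y))"
    using kernel_integrable[OF assms, of x] unfolding K_eq[OF assms(1)] by (simp add: mult.assoc)
  then have "integrable lborel (\<lambda>y. exp (- (ht y x / (2 * \<nu>))) * u y)"
    using gauss_const_pos assms(1) by simp
  then show "integrable lborel (\<lambda>w. exp (- (ht (a + sqrt \<nu> *\<^sub>R w) x / (2 * \<nu>))) * u (a + sqrt \<nu> *\<^sub>R w))"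
    using lborel_integrable_affine_iff[OF nz m, of a] by simp
qed

lemma bounded_measurable_1: "bounded_measurable (\<lambda>_. 1)" by (auto simp: bounded_measurable_def)

lemma bounded_measurable_mult: "bounded_measurable u \<Longrightarrow> c \<ge> 0 \<Longrightarrow> bounded_measurable (\<lambda>x. c * u x)"
  unfolding bounded_measurable_def by (auto intro!: mult_nonneg_nonneg exI[of _ "c * _"] mult_left_mono)

lemma bounded_measurable_L_iterate: "\<nu> > 0 \<Longrightarrow> bounded_measurable ((L \<nu> ^^ n) (\<lambda>_. 1))"
  by (induction n) (auto intro: bounded_measurable_L bounded_measurable_1)

lemma supersolution_iterate:
  assumes "\<nu> > 0" "bounded_measurable \<Phi>" "\<mu> \<ge> 0" "\<And>x. 1 \<le> \<Phi> x" "\<And>x. L \<nu> \<Phi> x \<le> \<mu> * \<Phi> x"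
  shows "(L \<nu> ^^ n) (\<lambda>_. 1) x \<le> \<mu> ^ n * \<Phi> x"
proof (induction n arbitrary: x)
  case (Suc n)
  have "(L \<nu> ^^ Suc n) (\<lambda>_. 1) x \<le> L \<nu> (\<lambda>x. \<mu> ^ n * \<Phi> x) x"
    using Suc assms by (auto intro!: L_mono bounded_measurable_L_iterate bounded_measurable_mult)
  also have "\<dots> = \<mu> ^ n * L \<nu> \<Phi> x" by (rule L_scale)
  also have "\<dots> \<le> \<mu> ^ n * (\<mu> * \<Phi> x)" using assms by (intro mult_left_mono) auto
  finally show ?case by (simp add: mult_ac)
qed (use assms in auto)

lemma subsolution_iterate:
  assumes "\<nu> > 0" "bounded_measurable \<Phi>" "\<mu> \<ge> 0" "\<And>x. \<Phi> x \<le> 1" "\<And>x. L \<nu> \<Phi> x \<ge> \<mu> * \<Phi> x"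
  shows "(L \<nu> ^^ n) (\<lambda>_. 1) x \<ge> \<mu> ^ n * \<Phi> x"
proof (induction n arbitrary: x)
  case (Suc n)
  have "\<mu> ^ Suc n * \<Phi> x \<le> \<mu> ^ n * L \<nu> \<Phi> x"
    using mult_left_mono[OF assms(5), of "\<mu> ^ n"] assms(3) by (simp add: mult_ac)
  also have "\<dots> = L \<nu> (\<lambda>x. \<mu> ^ n * \<Phi> x) x" by (rule L_scale[symmetric])
  also have "\<dots> \<le> (L \<nu> ^^ Suc n) (\<lambda>_. 1) x"
    using Suc assms by (auto intro!: L_mono bounded_measurable_L_iterate bounded_measurable_mult)
  finally show ?case .
qed (use assms in auto)

section \<open>Rescaling around a minimizer\<close>

text \<open>The exponent of the kernel in the variable \<open>w\<close> for which the integration point is \<open>y + sqrt \<nu> w\<close>.\<close>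

definition energy :: "real \<Rightarrow> real ^ 'd \<Rightarrow> real ^ 'd \<Rightarrow> real ^ 'd \<Rightarrow> real" where
  "energy \<nu> x y w = ht (y + sqrt \<nu> *\<^sub>R w) x / (2 * \<nu>)"

text \<open>A single integrable weight that dominates all error terms: the moments up to order four of the
  Gaussian \<open>exp (- \<delta> / 2 * (norm w)\<^sup>2)\<close>, and this Gaussian with half the exponent.\<close>

definition wt :: "real ^ 'd \<Rightarrow> real" where
  "wt w = (1 + norm w) ^ 4 * exp (- (\<delta> / 4) * (norm w)\<^sup>2)"

text \<open>The factor gained in one step at a lattice point, to leading order as \<open>\<nu>\<close> tends to \<open>0\<close>.\<close>

definition \<kappa> :: real where "\<kappa> = gauss_const * (LINT w|lborel. exp (- (q w / 2)))"

definition wt_mass :: real where "wt_mass = gauss_const * (LINT w|lborel. wt w)"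

lemma energy_measurable[measurable]: "energy \<nu> x y \<in> borel_measurable borel"
  unfolding energy_def[abs_def] by measurable

lemma wt_integrable: "integrable lborel wt"
  unfolding wt_def[abs_def] using integrable_gaussian_weight[of "\<delta> / 4"] \<delta>_pos by simp

lemma power_exp_le_wt:
  assumes "k \<le> 4"
  shows "norm w ^ k * exp (- (\<delta> / 2 * (norm w)\<^sup>2)) \<le> wt w"
proof -
  have "norm w ^ k \<le> (1 + norm w) ^ k" by (intro power_mono) auto
  also have "\<dots> \<le> (1 + norm w) ^ 4" using assms by (intro power_increasing) auto
  finally have 1: "norm w ^ k \<le> (1 + norm w) ^ 4" .
  have "exp (- (\<delta> / 2 * (norm w)\<^sup>2)) \<le> exp (- (\<delta> / 4) * (norm w)\<^sup>2)"
    using \<delta>_pos by (simp add: mult_right_mono)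
  with 1 show ?thesis unfolding wt_def by (intro mult_mono) auto
qed

lemma q_exp_integrable:
  assumes "a \<ge> 1"
  shows "integrable lborel (\<lambda>w. exp (- (a * q w / 2)))"
proof (rule Bochner_Integration.integrable_bound[OF integrable_gaussian[of "\<delta> / 2"]])
  have "exp (- (a * q w / 2)) \<le> exp (- (\<delta> / 2) * (norm w)\<^sup>2)" for w
  proof -
    have "0 \<le> \<delta> * (norm w)\<^sup>2" using \<delta>_pos by simp
    then have "1 * (\<delta> * (norm w)\<^sup>2) \<le> a * q w"
      using assms q_lower[of w] by (intro mult_mono) auto
    then show ?thesis by simp
  qed
  then show "AE w in lborel. norm (exp (- (a * q w / 2))) \<le> norm (exp (- (\<delta> / 2) * (norm w)\<^sup>2))"
    by simp
qed (use \<delta>_pos in auto)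

lemma \<kappa>_pos: "\<kappa> > 0"
  unfolding \<kappa>_def using gauss_const_pos q_exp_integrable[of 1] by (intro mult_pos_pos integral_pos_of_pos) auto

lemma wt_mass_pos: "wt_mass > 0"
proof -
  have "wt w > 0" for w unfolding wt_def by (intro mult_pos_pos zero_less_power add_pos_nonneg) auto
  then show ?thesis
    unfolding wt_mass_def using gauss_const_pos wt_integrable by (intro mult_pos_pos integral_pos_of_pos)
qed

text \<open>Enlarging \<open>q\<close> by the factor \<open>1 + \<tau>\<close> is a dilation and divides the integral by \<open>(1 + \<tau>) powr (d/2)\<close>,
  which is at most \<open>exp (\<tau> * d / 2)\<close>.  The exponential form is what \<open>exp (- K * s)\<close> can compensate.\<close>

lemma scaled_gaussian_integral:
  assumes "\<tau> \<ge> 0"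
  shows "gauss_const * (LINT w|lborel. exp (- ((1 + \<tau>) * q w / 2))) \<ge> \<kappa> * exp (- (\<tau> * (real CARD('d) / 2)))"
proof -
  define c where "c = sqrt (1 + \<tau>)"
  have c: "c > 0" "c\<^sup>2 = 1 + \<tau>" using assms by (auto simp: c_def)
  have "(LINT w|lborel. exp (- (q w / 2))) = \<bar>c\<bar> ^ DIM(real ^ 'd) * (LINT w|lborel. exp (- (q (0 + c *\<^sub>R w) / 2)))"
    by (rule lborel_integral_affine) (use c in auto)
  also have "\<dots> = c ^ CARD('d) * (LINT w|lborel. exp (- ((1 + \<tau>) * q w / 2)))"
    using c by (simp add: q_scale)
  finally have eq: "\<kappa> = c ^ CARD('d) * (gauss_const * (LINT w|lborel. exp (- ((1 + \<tau>) * q w / 2))))"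
    by (simp add: \<kappa>_def)
  have I: "0 \<le> gauss_const * (LINT w|lborel. exp (- ((1 + \<tau>) * q w / 2)))"
    using gauss_const_pos by (intro mult_nonneg_nonneg Bochner_Integration.integral_nonneg) auto
  have "c \<le> exp (\<tau> / 2)"
  proof (rule power2_le_imp_le)
    show "c\<^sup>2 \<le> (exp (\<tau> / 2))\<^sup>2" unfolding c(2) by (simp add: exp_double[symmetric])
  qed auto
  then have "c ^ CARD('d) \<le> exp (\<tau> / 2) ^ CARD('d)" using c by (intro power_mono) auto
  also have "\<dots> = exp (\<tau> * (real CARD('d) / 2))" by (simp add: exp_of_nat_mult[symmetric])
  finally have "\<kappa> \<le> exp (\<tau> * (real CARD('d) / 2)) * (gauss_const * (LINT w|lborel. exp (- ((1 + \<tau>) * q w / 2))))"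
    unfolding eq using I by (rule mult_right_mono)
  then have "\<kappa> * exp (- (\<tau> * (real CARD('d) / 2))) \<le> exp (\<tau> * (real CARD('d) / 2)) *
      (gauss_const * (LINT w|lborel. exp (- ((1 + \<tau>) * q w / 2)))) * exp (- (\<tau> * (real CARD('d) / 2)))"
    by (intro mult_right_mono) auto
  then show ?thesis by (simp add: exp_minus field_simps)
qed

lemma energy_lower:
  assumes "x \<in> U" "calibrated y x" "\<nu> > 0"
  shows "energy \<nu> x y w \<ge> \<delta> / 2 * (norm w)\<^sup>2"
proof -
  have "\<delta> * (norm (sqrt \<nu> *\<^sub>R w))\<^sup>2 \<le> ht (y + sqrt \<nu> *\<^sub>R w) x"
    using ht_lower_quadratic[OF assms(1,2), of "y + sqrt \<nu> *\<^sub>R w"] by simp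
  then show ?thesis using assms(3) by (simp add: energy_def power_mult_distrib field_simps)
qed

lemma energy_approx:
  obtains C where "C > 0" "\<And>\<nu> x y w. calibrated y x \<Longrightarrow> \<nu> > 0 \<Longrightarrow>
    \<bar>energy \<nu> x y w - q w / 2\<bar> \<le> C * (sqrt \<nu> * norm w + lattice_dist y) * (norm w)\<^sup>2"
proof -
  obtain C where C: "C > 0" "\<And>x y v. calibrated y x \<Longrightarrow>
      \<bar>ht (y + v) x - q v\<bar> \<le> C * (norm v + lattice_dist y) * (norm v)\<^sup>2"
    using ht_approx_q by blast
  have "\<bar>energy \<nu> x y w - q w / 2\<bar> \<le> C * (sqrt \<nu> * norm w + lattice_dist y) * (norm w)\<^sup>2"
    if "calibrated y x" "\<nu> > 0" for \<nu> x y w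
  proof -
    have "energy \<nu> x y w - q w / 2 = (ht (y + sqrt \<nu> *\<^sub>R w) x - q (sqrt \<nu> *\<^sub>R w)) / (2 * \<nu>)"
      using that by (simp add: energy_def q_scale field_simps)
    then have "\<bar>energy \<nu> x y w - q w / 2\<bar> = \<bar>ht (y + sqrt \<nu> *\<^sub>R w) x - q (sqrt \<nu> *\<^sub>R w)\<bar> / (2 * \<nu>)"
      using that by simp
    also have "\<dots> \<le> (C * (norm (sqrt \<nu> *\<^sub>R w) + lattice_dist y) * (norm (sqrt \<nu> *\<^sub>R w))\<^sup>2) / (2 * \<nu>)"
      using that by (intro divide_right_mono C) auto
    also have "\<dots> = C * (sqrt \<nu> * norm w + lattice_dist y) * (norm w)\<^sup>2 / 2"
      using that by (simp add: power_mult_distrib)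
    also have "\<dots> \<le> C * (sqrt \<nu> * norm w + lattice_dist y) * (norm w)\<^sup>2"
      using that C by (simp add: infdist_nonneg)
    finally show ?thesis .
  qed
  with C that show ?thesis by blast
qed

lemma L_energy:
  assumes "\<nu> > 0" "bounded_measurable u"
  shows "L \<nu> u x = gauss_const * (LINT w|lborel. exp (- energy \<nu> x y w) * u (y + sqrt \<nu> *\<^sub>R w))"
    and "integrable lborel (\<lambda>w. exp (- energy \<nu> x y w) * u (y + sqrt \<nu> *\<^sub>R w))"
  using L_rescaled[OF assms, of x y] rescaled_integrable[OF assms, of y x]
  unfolding energy_def by auto

section \<open>Supersolution and subsolution\<close>

definition super :: "real \<Rightarrow> real \<Rightarrow> real \<Rightarrow> real ^ 'd \<Rightarrow> real" where
  "super K M \<nu> x = (if x \<in> U then exp (K * s x) else M * \<nu> powr (- (real CARD('d) / 2)))"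

definition sub :: "real \<Rightarrow> real ^ 'd \<Rightarrow> real" where
  "sub K x = (if x \<in> U then exp (- K * s x) else 0)"

lemma bounded_measurable_super: "K \<ge> 0 \<Longrightarrow> M \<ge> 0 \<Longrightarrow> bounded_measurable (super K M \<nu>)"
proof -
  assume K: "K \<ge> 0" "M \<ge> 0"
  obtain S where S: "S > 0" "\<And>x. s x \<le> S" using s_bounded by blast
  have "0 \<le> super K M \<nu> x \<and> super K M \<nu> x \<le> max (exp (K * S)) (M * \<nu> powr (- (real CARD('d) / 2)))" for x
    using K S by (auto simp: super_def le_max_iff_disj mult_left_mono)
  moreover have "super K M \<nu> \<in> borel_measurable borel" unfolding super_def[abs_def] by measurable
  ultimately show ?thesis unfolding bounded_measurable_def by blast
qed

lemma sub_le_1: "K \<ge> 0 \<Longrightarrow> sub K x \<le> 1" and sub_nonneg: "sub K x \<ge> 0"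
  by (auto simp: sub_def s_nonneg)

lemma bounded_measurable_sub: "K \<ge> 0 \<Longrightarrow> bounded_measurable (sub K)"
proof -
  assume K: "K \<ge> 0"
  have "sub K \<in> borel_measurable borel" unfolding sub_def[abs_def] by measurable
  then show ?thesis unfolding bounded_measurable_def using sub_nonneg sub_le_1[OF K] by blast
qed

text \<open>The integrand is compared with \<open>exp (- q w / 2)\<close>.  The error proportional to \<open>lattice_dist y\<close> is
  compensated by the decrease of \<open>s\<close> between \<open>x\<close> and \<open>y\<close>; everything else is \<open>O(sqrt \<nu>)\<close>.  The constant \<open>K\<close> must not
  depend on \<open>M\<close>, which is chosen afterwards in terms of \<open>K\<close>.\<close>

lemma L_super_on_U:
  obtains K A where "K > 0" "\<And>M. M \<ge> 0 \<Longrightarrow> A M \<ge> 0" "\<And>M \<nu> x. M \<ge> 0 \<Longrightarrow> 0 < \<nu> \<Longrightarrow> \<nu> \<le> 1 \<Longrightarrow> x \<in> U \<Longrightarrow>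
     L \<nu> (super K M \<nu>) x \<le> \<kappa> * (1 + A M * sqrt \<nu>) * super K M \<nu> x"
proof -
  obtain c where c: "c > 0" "\<And>x y. calibrated y x \<Longrightarrow> s y + c * lattice_dist y \<le> s x"
    using s_decrease by blast
  obtain C where C: "C > 0" and approx: "\<And>\<nu> x y w. calibrated y x \<Longrightarrow> \<nu> > 0 \<Longrightarrow>
    \<bar>energy \<nu> x y w - q w / 2\<bar> \<le> C * (sqrt \<nu> * norm w + lattice_dist y) * (norm w)\<^sup>2"
    using energy_approx by blast
  obtain S where S: "S > 0" "\<And>x. s x \<le> S" using s_bounded by blast
  obtain C' where C': "C' > 0" "\<And>\<nu>. 0 < \<nu> \<Longrightarrow> \<nu> \<le> 1 \<Longrightarrow> \<nu> powr (- (real CARD('d) / 2)) \<le> C' * sqrt \<nu> * exp (\<delta> / 4 / \<nu>)"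
    using singular_power_le_exp[of "\<delta> / 4" "real CARD('d) / 2"] \<delta>_pos by auto
  \<comment> \<open>Chosen so that \<open>\<kappa> * (1 + K * c * D) = \<kappa> + C * D * wt_mass\<close>, the factor in front of \<open>exp (K * s y)\<close> up to \<open>O(sqrt \<nu>)\<close>.\<close>
  define K where "K = C * wt_mass / (\<kappa> * c)"
  have K: "K > 0" using C wt_mass_pos \<kappa>_pos c by (simp add: K_def)
  define A' where "A' M = C + K * exp (K * S) + M * C'" for M
  have "L \<nu> (super K M \<nu>) x \<le> \<kappa> * (1 + A' M * wt_mass / \<kappa> * sqrt \<nu>) * super K M \<nu> x"
    if M: "M \<ge> 0" and \<nu>: "0 < \<nu>" "\<nu> \<le> 1" and x: "x \<in> U" for M \<nu> x
  proof -
    obtain y where y: "calibrated y x" using calibrated_exists by blast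
    define D where "D = lattice_dist y"
    have D: "D \<ge> 0" by (simp add: D_def infdist_nonneg)
    define \<sigma> where "\<sigma> = sqrt \<nu>"
    have \<sigma>: "\<sigma> > 0" using \<nu> by (simp add: \<sigma>_def)
    have A': "A' M \<ge> 0" using C K M C' by (simp add: A'_def)
    have pointwise: "exp (- energy \<nu> x y w) * super K M \<nu> (y + \<sigma> *\<^sub>R w)
        \<le> exp (K * s y) * (exp (- (q w / 2)) + C * D * wt w + \<sigma> * A' M * wt w)" for w
    proof -
      define z where "z = y + \<sigma> *\<^sub>R w"
      define t where "t = norm w"
      define E where "E = energy \<nu> x y w"
      define e where "e = exp (- (\<delta> / 2 * t\<^sup>2))"
      have t: "t \<ge> 0" by (simp add: t_def)
      have e: "e > 0" by (simp add: e_def)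
      have wt: "t ^ k * e \<le> wt w" if "k \<le> 4" for k
        using power_exp_le_wt[OF that, of w] by (simp add: t_def e_def)
      have Elow: "E \<ge> \<delta> / 2 * t\<^sup>2" using energy_lower[OF x y \<nu>(1)] by (simp add: E_def t_def)
      then have Ee: "exp (- E) \<le> e" by (simp add: e_def)
      have qe: "exp (- (q w / 2)) \<le> e" using q_lower[of w] by (simp add: e_def t_def)
      show ?thesis
      proof (cases "z \<in> U")
        case True
        have gauss: "exp (- E) \<le> exp (- (q w / 2)) + C * (\<sigma> * t + D) * (t\<^sup>2 * e)"
        proof (cases "E \<ge> q w / 2")
          case True
          then have "exp (- E) \<le> exp (- (q w / 2))" by simp
          then show ?thesis using C \<sigma> t D e by (simp add: add_increasing2)
        next
          case False
          have "1 + (E - q w / 2) \<le> exp (E - q w / 2)" by (rule exp_ge_add_one_self)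
          then have "exp (- E) * (1 + (E - q w / 2)) \<le> exp (- E) * exp (E - q w / 2)"
            by (intro mult_left_mono) auto
          also have "\<dots> = exp (- (q w / 2))" by (simp add: exp_add[symmetric])
          finally have "exp (- E) \<le> exp (- (q w / 2)) + (q w / 2 - E) * exp (- E)"
            by (simp add: algebra_simps)
          also have "(q w / 2 - E) * exp (- E) \<le> (C * (\<sigma> * t + D) * t\<^sup>2) * e"
            using approx[OF y \<nu>(1), of w] False Ee
            by (intro mult_mono) (auto simp: E_def \<sigma>_def t_def D_def)
          finally show ?thesis by (simp add: mult_ac)
        qed
        have phi: "exp (K * s z) \<le> exp (K * s y) * (1 + K * exp (K * S) * \<sigma> * t)"
        proof (cases "s z \<le> s y")
          case True
          then have "exp (K * s z) \<le> exp (K * s y) * 1" using K by simp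
          also have "\<dots> \<le> exp (K * s y) * (1 + K * exp (K * S) * \<sigma> * t)"
            using K \<sigma> t by (intro mult_left_mono) auto
          finally show ?thesis .
        next
          case False
          define a where "a = K * (s z - s y)"
          have a: "a \<ge> 0" using False K by (simp add: a_def)
          have "s z \<le> s y + \<sigma> * t" using s_lipschitz[of z y] \<sigma> by (simp add: z_def t_def)
          then have a1: "a \<le> K * (\<sigma> * t)" unfolding a_def using K by (intro mult_left_mono) auto
          have a2: "a \<le> K * S" unfolding a_def using K S(2)[of z] s_nonneg[of y] by (intro mult_left_mono) auto
          have "1 - a \<le> exp (- a)" using exp_ge_add_one_self[of "- a"] by simp
          then have "exp a * (1 - a) \<le> exp a * exp (- a)" by (intro mult_left_mono) auto
          then have "exp a \<le> 1 + a * exp a" by (simp add: exp_minus algebra_simps)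
          also have "a * exp a \<le> K * (\<sigma> * t) * exp (K * S)"
            using a a1 a2 by (intro mult_mono) auto
          finally have "exp a \<le> 1 + K * exp (K * S) * \<sigma> * t" by (simp add: mult_ac)
          then have "exp (K * s y) * exp a \<le> exp (K * s y) * (1 + K * exp (K * S) * \<sigma> * t)"
            by (intro mult_left_mono) auto
          then show ?thesis by (simp add: a_def exp_add[symmetric] algebra_simps)
        qed
        have "exp (- E) * exp (K * s z) \<le> exp (- E) * (exp (K * s y) * (1 + K * exp (K * S) * \<sigma> * t))"
          using phi by (intro mult_left_mono) auto
        also have "\<dots> = exp (K * s y) * (exp (- E) + K * exp (K * S) * \<sigma> * t * exp (- E))"
          by (simp add: algebra_simps)
        also have "\<dots> \<le> exp (K * s y) * (exp (- (q w / 2)) + C * D * wt w + \<sigma> * A' M * wt w)"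
        proof (rule mult_left_mono)
          have "K * exp (K * S) * \<sigma> * t * exp (- E) \<le> K * exp (K * S) * \<sigma> * t * e"
            using Ee K \<sigma> t by (intro mult_left_mono) auto
          also have "\<dots> = K * exp (K * S) * \<sigma> * (t ^ 1 * e)" by simp
          also have "\<dots> \<le> K * exp (K * S) * \<sigma> * wt w"
            using K \<sigma> by (intro mult_left_mono wt) auto
          finally have 1: "K * exp (K * S) * \<sigma> * t * exp (- E) \<le> K * exp (K * S) * \<sigma> * wt w" .
          have "C * (\<sigma> * t + D) * (t\<^sup>2 * e) = C * \<sigma> * (t ^ 3 * e) + C * D * (t ^ 2 * e)"
            by (simp add: power2_eq_square power3_eq_cube algebra_simps)
          also have "\<dots> \<le> C * \<sigma> * wt w + C * D * wt w"
            using C \<sigma> D by (intro add_mono mult_left_mono wt) auto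
          finally have "exp (- E) + K * exp (K * S) * \<sigma> * t * exp (- E)
              \<le> exp (- (q w / 2)) + C * \<sigma> * wt w + C * D * wt w + K * exp (K * S) * \<sigma> * wt w"
            using gauss 1 by linarith
          also have "\<dots> = exp (- (q w / 2)) + C * D * wt w + \<sigma> * (C + K * exp (K * S)) * wt w"
            by (simp add: algebra_simps)
          also have "\<dots> \<le> exp (- (q w / 2)) + C * D * wt w + \<sigma> * A' M * wt w"
            using M C' \<sigma> wt[of 0] e by (intro add_left_mono mult_right_mono mult_left_mono) (auto simp: A'_def)
          finally show "exp (- E) + K * exp (K * S) * \<sigma> * t * exp (- E)
              \<le> exp (- (q w / 2)) + C * D * wt w + \<sigma> * A' M * wt w" .
        qed auto
        finally show ?thesis using True by (simp add: super_def E_def z_def)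
      next
        case False
        \<comment> \<open>Half of the energy pays for the power of \<open>\<nu>\<close>, the other half for integrability in \<open>w\<close>.\<close>
        have "E \<ge> \<delta> / (2 * \<nu>)"
          using ht_outside[OF False, of x] \<nu> unfolding E_def energy_def z_def \<sigma>_def by (intro divide_right_mono) auto
        then have "- E \<le> - (\<delta> / 4 / \<nu>) + - (\<delta> / 4 * t\<^sup>2)"
          using Elow by (simp add: field_simps)
        then have "exp (- E) \<le> exp (- (\<delta> / 4 / \<nu>)) * exp (- (\<delta> / 4 * t\<^sup>2))"
          by (simp only: exp_add[symmetric] exp_le_cancel_iff)
        also have "exp (- (\<delta> / 4 * t\<^sup>2)) \<le> wt w"
          using t mult_right_mono[of 1 "(1 + t) ^ 4" "exp (- (\<delta> / 4 * t\<^sup>2))"] one_le_power[of "1 + t" 4]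
          by (simp add: wt_def t_def)
        finally have "exp (- E) \<le> exp (- (\<delta> / 4 / \<nu>)) * wt w" by simp
        then have "exp (- E) * (M * \<nu> powr (- (real CARD('d) / 2)))
            \<le> exp (- (\<delta> / 4 / \<nu>)) * wt w * (M * (C' * \<sigma> * exp (\<delta> / 4 / \<nu>)))"
          using C'(2)[OF \<nu>] M wt[of 0] e unfolding \<sigma>_def
          by (intro mult_mono mult_left_mono) auto
        also have "\<dots> = \<sigma> * (M * C') * wt w"
          by (simp add: exp_minus field_simps)
        also have "\<dots> \<le> \<sigma> * A' M * wt w"
          using C K \<sigma> wt[of 0] e by (intro mult_right_mono mult_left_mono) (auto simp: A'_def)
        also have "\<dots> \<le> exp (- (q w / 2)) + C * D * wt w + \<sigma> * A' M * wt w"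
          using C D wt[of 0] e by (simp add: add_nonneg_nonneg)
        also have "\<dots> = 1 * \<dots>" by simp
        also have "\<dots> \<le> exp (K * s y) * (exp (- (q w / 2)) + C * D * wt w + \<sigma> * A' M * wt w)"
          using C D wt[of 0] e A' \<sigma> K s_nonneg[of y] by (intro mult_right_mono add_nonneg_nonneg) auto
        finally show ?thesis using False by (simp add: super_def E_def z_def)
      qed
    qed
    have int: "integrable lborel (\<lambda>w. exp (K * s y) * (exp (- (q w / 2)) + C * D * wt w + \<sigma> * A' M * wt w))"
      using wt_integrable q_exp_integrable[of 1] by simp
    have bS: "bounded_measurable (super K M \<nu>)" using K M by (intro bounded_measurable_super) auto
    have "L \<nu> (super K M \<nu>) x \<le> gauss_const * (LINT w|lborel. exp (K * s y) * (exp (- (q w / 2)) + C * D * wt w + \<sigma> * A' M * wt w))"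
      unfolding L_energy(1)[OF \<nu>(1) bS, of x y]
      using gauss_const_pos L_energy(2)[OF \<nu>(1) bS, of x y] int pointwise
      by (intro mult_left_mono integral_mono) (auto simp: \<sigma>_def)
    also have "\<dots> = exp (K * s y) * (\<kappa> + C * D * wt_mass + \<sigma> * A' M * wt_mass)"
      using wt_integrable q_exp_integrable[of 1]
      by (simp add: \<kappa>_def wt_mass_def algebra_simps)
    also have "\<dots> \<le> exp (K * s x) * exp (- (K * c * D)) * (\<kappa> * exp (K * c * D) + \<sigma> * A' M * wt_mass)"
    proof (rule mult_mono)
      have "K * (s y + c * D) \<le> K * s x" using c(2)[OF y] K by (simp add: D_def)
      then show "exp (K * s y) \<le> exp (K * s x) * exp (- (K * c * D))"
        by (simp add: exp_add[symmetric] algebra_simps)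
      have "\<kappa> * (1 + K * c * D) \<le> \<kappa> * exp (K * c * D)"
        using \<kappa>_pos by (intro mult_left_mono exp_ge_add_one_self) auto
      moreover have "\<kappa> * (1 + K * c * D) = \<kappa> + C * D * wt_mass"
        using \<kappa>_pos c by (simp add: K_def field_simps)
      ultimately show "\<kappa> + C * D * wt_mass + \<sigma> * A' M * wt_mass \<le> \<kappa> * exp (K * c * D) + \<sigma> * A' M * wt_mass"
        by simp
    qed (use C D \<sigma> A' \<kappa>_pos wt_mass_pos in auto)
    also have "\<dots> = exp (K * s x) * (\<kappa> + exp (- (K * c * D)) * (\<sigma> * A' M * wt_mass))"
      by (simp add: exp_minus field_simps)
    also have "\<dots> \<le> exp (K * s x) * (\<kappa> + 1 * (\<sigma> * A' M * wt_mass))"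
      using K c D \<sigma> A' wt_mass_pos by (intro mult_left_mono add_left_mono mult_right_mono) auto
    also have "\<dots> = \<kappa> * (1 + A' M * wt_mass / \<kappa> * sqrt \<nu>) * super K M \<nu> x"
      using x \<kappa>_pos by (simp add: super_def \<sigma>_def field_simps)
    finally show ?thesis .
  qed
  moreover have "A' M * wt_mass / \<kappa> \<ge> 0" if "M \<ge> 0" for M
    using that C K C' wt_mass_pos \<kappa>_pos by (simp add: A'_def)
  ultimately show ?thesis using K that[of K "\<lambda>M. A' M * wt_mass / \<kappa>"] by blast
qed

text \<open>Off \<open>U\<close> only a crude bound of order \<open>\<nu> powr (- d/2)\<close> is available, coming from the size of the kernel.  What
  matters is that \<open>M\<close> enters with the small factor \<open>sqrt \<nu>\<close>, so that \<open>M\<close> can be chosen to dominate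
  \<open>C3\<close>.\<close>

lemma L_super_global:
  assumes "K > 0"
  obtains C3 C4 where "C3 \<ge> 0" "C4 \<ge> 0" "\<And>M \<nu> x. M \<ge> 0 \<Longrightarrow> 0 < \<nu> \<Longrightarrow> \<nu> \<le> 1 \<Longrightarrow>
     L \<nu> (super K M \<nu>) x \<le> \<nu> powr (- (real CARD('d) / 2)) * (C3 + C4 * M * sqrt \<nu>)"
proof -
  obtain S where S: "S > 0" "\<And>x. s x \<le> S" using s_bounded by blast
  obtain C' where C': "C' > 0" "\<And>\<nu>. 0 < \<nu> \<Longrightarrow> \<nu> \<le> 1 \<Longrightarrow> \<nu> powr (- (real CARD('d) / 2)) \<le> C' * sqrt \<nu> * exp (\<delta> / 4 / \<nu>)"
    using singular_power_le_exp[of "\<delta> / 4" "real CARD('d) / 2"] \<delta>_pos by auto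
  obtain B where B: "B > 0" "\<And>x y. ht y x \<ge> (norm (x - y))\<^sup>2 / 2 - B" using ht_lower_global by blast
  define T where "T = (LINT y|lborel. exp (- (1 / 8) * (norm (y :: real ^ 'd))\<^sup>2))"
  have T: "T \<ge> 0" unfolding T_def by (intro Bochner_Integration.integral_nonneg) auto
  define C3 where "C3 = gauss_const * exp (K * S) * exp (B / 4) * T"
  define C4 where "C4 = gauss_const * C' * exp (B / 4) * T"
  have "L \<nu> (super K M \<nu>) x \<le> \<nu> powr (- (real CARD('d) / 2)) * (C3 + C4 * M * sqrt \<nu>)"
    if M: "M \<ge> 0" and \<nu>: "0 < \<nu>" "\<nu> \<le> 1" for M \<nu> x
  proof -
    have bS: "bounded_measurable (super K M \<nu>)" using assms M by (intro bounded_measurable_super) auto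
    define b where "b = exp (K * S) + M * C' * sqrt \<nu>"
    have b: "b \<ge> 0" using M C' \<nu> by (simp add: b_def)
    have "exp (- ht y x / (2 * \<nu>)) * super K M \<nu> y \<le> b * exp (- ht y x / 4)" for y
    proof (cases "y \<in> U")
      case True
      have "ht y x * \<nu> \<le> ht y x * 2" using \<nu> ht_nonneg by (intro mult_left_mono) auto
      then have "exp (- ht y x / (2 * \<nu>)) \<le> exp (- ht y x / 4)" using \<nu> by (simp add: field_simps)
      moreover have "super K M \<nu> y \<le> b"
      proof -
        have "K * s y \<le> K * S" using S assms by simp
        then have "exp (K * s y) \<le> exp (K * S)" by simp
        moreover have "0 \<le> M * C' * sqrt \<nu>" using M C' \<nu> by simp
        ultimately have "exp (K * s y) \<le> b" unfolding b_def by linarith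
        then show ?thesis using True by (simp add: super_def)
      qed
      ultimately have "exp (- ht y x / (2 * \<nu>)) * super K M \<nu> y \<le> exp (- ht y x / 4) * b"
        using True by (intro mult_mono) (auto simp: super_def)
      then show ?thesis by (simp add: mult.commute)
    next
      case False
      have "ht y x * \<nu> \<le> ht y x * 1" using \<nu> ht_nonneg by (intro mult_left_mono) auto
      then have "- ht y x / (2 * \<nu>) \<le> - (\<delta> / 4 / \<nu>) + - ht y x / 4"
        using \<nu> ht_outside[OF False, of x] by (simp add: field_simps)
      then have "exp (- ht y x / (2 * \<nu>)) \<le> exp (- (\<delta> / 4 / \<nu>)) * exp (- ht y x / 4)"
        by (simp only: exp_add[symmetric] exp_le_cancel_iff)
      then have "exp (- ht y x / (2 * \<nu>)) * super K M \<nu> y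
          \<le> exp (- (\<delta> / 4 / \<nu>)) * exp (- ht y x / 4) * (M * (C' * sqrt \<nu> * exp (\<delta> / 4 / \<nu>)))"
        using False M C'(2)[OF \<nu>] by (intro mult_mono) (auto simp: super_def mult_left_mono)
      also have "\<dots> = M * C' * sqrt \<nu> * exp (- ht y x / 4)"
        by (simp add: exp_minus field_simps)
      also have "\<dots> \<le> b * exp (- ht y x / 4)" by (intro mult_right_mono) (auto simp: b_def)
      finally show ?thesis .
    qed
    moreover have "b * exp (- ht y x / 4) \<le> b * exp (B / 4) * exp (- (1 / 8) * (norm (x - y))\<^sup>2)" for y
    proof -
      have "exp (- ht y x / 4) \<le> exp (B / 4) * exp (- (1 / 8) * (norm (x - y))\<^sup>2)"
        using B(2)[of x y] by (simp add: exp_add[symmetric])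
      from mult_left_mono[OF this b] show ?thesis by (simp add: mult.assoc)
    qed
    ultimately have pw: "exp (- ht y x / (2 * \<nu>)) * super K M \<nu> y \<le> b * exp (B / 4) * exp (- (1 / 8) * (norm (x - y))\<^sup>2)" for y
      using order_trans by blast
    have "L \<nu> (super K M \<nu>) x \<le> (LINT y|lborel. gauss_const * \<nu> powr (- (real CARD('d) / 2)) * (b * exp (B / 4) * exp (- (1 / 8) * (norm (x - y))\<^sup>2)))"
      unfolding L_tilde_def
    proof (rule integral_mono)
      show "integrable lborel (\<lambda>y. gauss_const * \<nu> powr (- (real CARD('d) / 2)) * (b * exp (B / 4) * exp (- (1 / 8) * (norm (x - y))\<^sup>2)))"
        by (intro integrable_mult_right integrable_exp_dist) auto
      show "K_tilde F \<psi> \<nu> y x * super K M \<nu> y \<le> gauss_const * \<nu> powr (- (real CARD('d) / 2)) * (b * exp (B / 4) * exp (- (1 / 8) * (norm (x - y))\<^sup>2))" for y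
        unfolding K_eq[OF \<nu>(1)] mult.assoc[of "gauss_const * _"] using gauss_const_pos by (intro mult_left_mono pw) auto
    qed (rule kernel_integrable[OF \<nu>(1) bS])
    also have "\<dots> = gauss_const * \<nu> powr (- (real CARD('d) / 2)) * (b * exp (B / 4) * T)"
      using integrable_exp_dist(2)[of "1/8" x] by (simp add: T_def)
    also have "\<dots> = \<nu> powr (- (real CARD('d) / 2)) * (C3 + C4 * M * sqrt \<nu>)"
      by (simp add: C3_def C4_def b_def algebra_simps)
    finally show ?thesis .
  qed
  moreover have "C3 \<ge> 0" "C4 \<ge> 0" using gauss_const_pos C' T by (auto simp: C3_def C4_def)
  ultimately show ?thesis using that by blast
qed

lemma supersolution:
  obtains K M A where "K > 0" "M \<ge> 1" "A \<ge> 0"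
    "\<And>\<nu> x. 0 < \<nu> \<Longrightarrow> \<nu> \<le> 1 \<Longrightarrow> L \<nu> (super K M \<nu>) x \<le> \<kappa> * (1 + A * sqrt \<nu>) * super K M \<nu> x"
proof -
  obtain K A where K: "K > 0" and A: "\<And>M. M \<ge> 0 \<Longrightarrow> A M \<ge> 0" and inU: "\<And>M \<nu> x. M \<ge> 0 \<Longrightarrow> 0 < \<nu> \<Longrightarrow> \<nu> \<le> 1 \<Longrightarrow> x \<in> U \<Longrightarrow>
     L \<nu> (super K M \<nu>) x \<le> \<kappa> * (1 + A M * sqrt \<nu>) * super K M \<nu> x"
    using L_super_on_U by blast
  obtain C3 C4 where C: "C3 \<ge> 0" "C4 \<ge> 0" and gl: "\<And>M \<nu> x. M \<ge> 0 \<Longrightarrow> 0 < \<nu> \<Longrightarrow> \<nu> \<le> 1 \<Longrightarrow>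
     L \<nu> (super K M \<nu>) x \<le> \<nu> powr (- (real CARD('d) / 2)) * (C3 + C4 * M * sqrt \<nu>)"
    using L_super_global[OF K] by blast
  \<comment> \<open>Makes the term \<open>C3\<close>, which the crude bound leaves behind, at most \<open>\<kappa> * M\<close>.\<close>
  define M where "M = max 1 (C3 / \<kappa>)"
  have M: "M \<ge> 1" "M \<ge> 0" by (auto simp: M_def)
  have "C3 / \<kappa> \<le> M" by (simp add: M_def)
  then have C3: "C3 \<le> \<kappa> * M" using \<kappa>_pos by (simp add: field_simps)
  define A0 where "A0 = max (A M) (C4 / \<kappa>)"
  have A0: "A0 \<ge> A M" "A0 \<ge> C4 / \<kappa>" "A0 \<ge> 0" using A[OF M(2)] by (auto simp: A0_def)
  have "L \<nu> (super K M \<nu>) x \<le> \<kappa> * (1 + A0 * sqrt \<nu>) * super K M \<nu> x" if \<nu>: "0 < \<nu>" "\<nu> \<le> 1" for \<nu> x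
  proof (cases "x \<in> U")
    case True
    have "L \<nu> (super K M \<nu>) x \<le> \<kappa> * (1 + A M * sqrt \<nu>) * super K M \<nu> x" by (rule inU[OF M(2) \<nu> True])
    also have "\<dots> \<le> \<kappa> * (1 + A0 * sqrt \<nu>) * super K M \<nu> x"
      using A0 \<kappa>_pos \<nu> True by (intro mult_right_mono mult_left_mono add_left_mono) (auto simp: super_def)
    finally show ?thesis .
  next
    case False
    have "C3 + C4 * M * sqrt \<nu> \<le> \<kappa> * M + \<kappa> * A0 * M * sqrt \<nu>"
      using C3 A0(2) \<kappa>_pos M \<nu> by (intro add_mono mult_right_mono) (auto simp: field_simps)
    then have "\<nu> powr (- (real CARD('d) / 2)) * (C3 + C4 * M * sqrt \<nu>)
        \<le> \<nu> powr (- (real CARD('d) / 2)) * (\<kappa> * M + \<kappa> * A0 * M * sqrt \<nu>)"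
      by (intro mult_left_mono) auto
    with gl[OF M(2) \<nu>, of x] False show ?thesis by (simp add: super_def algebra_simps)
  qed
  with K M A0 that show ?thesis by blast
qed

text \<open>The part of the energy error that is proportional to \<open>lattice_dist y\<close> is at most a multiple of
  \<open>lattice_dist y * q w\<close>, so it amounts to enlarging \<open>q\<close>; the loss from \<open>scaled_gaussian_integral\<close> is then exactly offset by the choice of \<open>K\<close>.  Points
  off \<open>U\<close> have \<open>sqrt \<nu> * norm w \<ge> r\<close> and are charged to the error of order \<open>sqrt \<nu>\<close>.\<close>

lemma subsolution:
  obtains K A where "K > 0" "A > 0"
    "\<And>\<nu> x. 0 < \<nu> \<Longrightarrow> L \<nu> (sub K) x \<ge> \<kappa> * (1 - A * sqrt \<nu>) * sub K x"
proof -
  obtain c where c: "c > 0" "\<And>x y. calibrated y x \<Longrightarrow> s y + c * lattice_dist y \<le> s x"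
    using s_decrease by blast
  obtain C where C: "C > 0" and approx: "\<And>\<nu> x y w. calibrated y x \<Longrightarrow> \<nu> > 0 \<Longrightarrow>
    \<bar>energy \<nu> x y w - q w / 2\<bar> \<le> C * (sqrt \<nu> * norm w + lattice_dist y) * (norm w)\<^sup>2"
    using energy_approx by blast
  obtain S where S: "S > 0" "\<And>x. s x \<le> S" using s_bounded by blast
  obtain r where r: "r > 0" "\<And>x y. calibrated y x \<Longrightarrow> ball y r \<subseteq> U" using calibrated_ball_in_U by blast
  define C' where "C' = 2 * C / \<delta>"
  have C': "C' > 0" using C \<delta>_pos by (simp add: C'_def)
  \<comment> \<open>Chosen so that the loss \<open>exp (- (C' * D * d / 2))\<close> equals \<open>exp (- (K * c * D))\<close>, the factor by which \<open>exp (- K * s)\<close> is at least smaller at \<open>x\<close> than at \<open>y\<close>.\<close>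
  define K where "K = C' * (real CARD('d) / 2) / c"
  have K: "K > 0" using C' c by (simp add: K_def)
  define A' where "A' = C + K + 1 / r"
  have A': "A' > 0" using C K r by (simp add: A'_def add_pos_pos)
  define A where "A = A' * wt_mass * exp (K * S) / \<kappa>"
  have "\<kappa> * (1 - A * sqrt \<nu>) * sub K x \<le> L \<nu> (sub K) x" if \<nu>: "0 < \<nu>" for \<nu> x
  proof (cases "x \<in> U")
    case False
    have "bounded_measurable (L \<nu> (sub K))" using K \<nu> by (intro bounded_measurable_L bounded_measurable_sub) auto
    then show ?thesis using False by (auto simp: bounded_measurable_def sub_def)
  next
    case x: True
    obtain y where y: "calibrated y x" using calibrated_exists by blast
    define D where "D = lattice_dist y"
    have D: "D \<ge> 0" by (simp add: D_def infdist_nonneg)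
    define \<sigma> where "\<sigma> = sqrt \<nu>"
    have \<sigma>: "\<sigma> > 0" using \<nu> by (simp add: \<sigma>_def)
    have pointwise: "exp (- K * s y) * (exp (- ((1 + C' * D) * q w / 2)) - \<sigma> * A' * wt w)
        \<le> exp (- energy \<nu> x y w) * sub K (y + \<sigma> *\<^sub>R w)" for w
    proof -
      define z where "z = y + \<sigma> *\<^sub>R w"
      define t where "t = norm w"
      define E where "E = energy \<nu> x y w"
      define e where "e = exp (- (\<delta> / 2 * t\<^sup>2))"
      define m where "m = exp (- ((1 + C' * D) * q w / 2))"
      have t: "t \<ge> 0" by (simp add: t_def)
      have e: "e > 0" by (simp add: e_def)
      have wt: "t ^ k * e \<le> wt w" if "k \<le> 4" for k
        using power_exp_le_wt[OF that, of w] by (simp add: t_def e_def)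
      have q: "\<delta> * t\<^sup>2 \<le> q w" using q_lower[of w] by (simp add: t_def)
      have q0: "q w \<ge> 0" using q \<delta>_pos t by (meson mult_nonneg_nonneg less_imp_le order_trans zero_le_power2)
      have "1 * q w \<le> (1 + C' * D) * q w" using q0 C' D by (intro mult_right_mono) auto
      then have me: "m \<le> e" using q by (simp add: m_def e_def)
      have m: "m > 0" by (simp add: m_def)
      show ?thesis
      proof (cases "z \<in> U")
        case True
        have "E \<le> q w / 2 + C * (\<sigma> * t + D) * t\<^sup>2"
          using approx[OF y \<nu>, of w] by (simp add: E_def \<sigma>_def t_def D_def abs_le_iff)
        also have "\<dots> = q w / 2 + C * D / \<delta> * (\<delta> * t\<^sup>2) + C * \<sigma> * t ^ 3"
          using \<delta>_pos by (simp add: power2_eq_square power3_eq_cube algebra_simps)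
        also have "\<dots> \<le> q w / 2 + C * D / \<delta> * q w + C * \<sigma> * t ^ 3"
          using q C D \<delta>_pos \<sigma> t by (intro add_mono mult_left_mono) auto
        also have "\<dots> = (1 + C' * D) * q w / 2 + C * \<sigma> * t ^ 3"
          using \<delta>_pos by (simp add: C'_def field_simps)
        finally have E: "E \<le> (1 + C' * D) * q w / 2 + C * \<sigma> * t ^ 3" .
        have "s z \<le> s y + \<sigma> * t" using s_lipschitz[of z y] \<sigma> by (simp add: z_def t_def)
        then have sz: "K * s z \<le> K * s y + K * (\<sigma> * t)" using K mult_left_mono[of "s z" "s y + \<sigma> * t" K] by (simp add: algebra_simps)
        define a where "a = C * \<sigma> * t ^ 3 + K * (\<sigma> * t)"
        have "m * a = C * \<sigma> * (t ^ 3 * m) + K * \<sigma> * (t ^ 1 * m)" by (simp add: a_def algebra_simps)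
        also have "\<dots> \<le> C * \<sigma> * (t ^ 3 * e) + K * \<sigma> * (t ^ 1 * e)"
          using C K \<sigma> t me by (intro add_mono mult_left_mono) auto
        also have "\<dots> \<le> C * \<sigma> * wt w + K * \<sigma> * wt w"
          using C K \<sigma> by (intro add_mono mult_left_mono wt) auto
        also have "\<dots> = \<sigma> * (C + K) * wt w" by (simp add: algebra_simps)
        also have "\<dots> \<le> \<sigma> * A' * wt w"
          using \<sigma> r wt[of 0] e by (intro mult_right_mono mult_left_mono) (auto simp: A'_def)
        finally have ma: "m * a \<le> \<sigma> * A' * wt w" .
        have "exp (- K * s y) * (m - \<sigma> * A' * wt w) \<le> exp (- K * s y) * (m - m * a)"
          using ma by (intro mult_left_mono) auto
        also have "\<dots> = exp (- K * s y) * (m * (1 - a))" by (simp add: algebra_simps)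
        also have "\<dots> \<le> exp (- K * s y) * (m * exp (- a))"
          using m exp_ge_add_one_self[of "- a"] by (intro mult_left_mono) auto
        also have "\<dots> = exp (- K * s y + (- ((1 + C' * D) * q w / 2) + - a))"
          unfolding m_def exp_add ..
        also have "\<dots> \<le> exp (- E + - K * s z)"
          using E sz by (simp add: a_def)
        also have "\<dots> = exp (- E) * exp (- K * s z)" by (rule exp_add)
        finally show ?thesis using True by (simp add: sub_def z_def m_def E_def)
      next
        case False
        have "z \<notin> ball y r" using False r(2)[OF y] by blast
        then have "\<sigma> * t \<ge> r" using \<sigma> by (simp add: z_def t_def dist_norm)
        then have rt: "1 \<le> \<sigma> * (1 / r) * t" using r by (simp add: field_simps)
        have "m \<le> 1 * e" using me by simp
        also have "\<dots> \<le> (\<sigma> * (1 / r) * t) * e" using rt e by (intro mult_right_mono) auto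
        also have "\<dots> = \<sigma> * (1 / r) * (t ^ 1 * e)" by simp
        also have "\<dots> \<le> \<sigma> * (1 / r) * wt w" using \<sigma> r by (intro mult_left_mono wt) auto
        also have "\<dots> \<le> \<sigma> * A' * wt w"
          using \<sigma> C K wt[of 0] e by (intro mult_right_mono mult_left_mono) (auto simp: A'_def)
        finally have "exp (- K * s y) * (m - \<sigma> * A' * wt w) \<le> 0"
          by (intro mult_nonneg_nonpos) auto
        then show ?thesis using False by (simp add: sub_def z_def m_def)
      qed
    qed
    have D1: "1 + C' * D \<ge> 1" using C' D by simp
    have int: "integrable lborel (\<lambda>w. exp (- K * s y) * (exp (- ((1 + C' * D) * q w / 2)) - \<sigma> * A' * wt w))"
      using wt_integrable q_exp_integrable[OF D1] by (intro integrable_mult_right Bochner_Integration.integrable_diff) auto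
    have bS: "bounded_measurable (sub K)" using K by (intro bounded_measurable_sub) auto
    have "\<kappa> * exp (- (K * c * D)) \<le> gauss_const * (LINT w|lborel. exp (- ((1 + C' * D) * q w / 2)))"
      using scaled_gaussian_integral[of "C' * D"] C' D c by (simp add: K_def mult_ac)
    then have main: "exp (- K * s y) * (\<kappa> * exp (- (K * c * D)) - \<sigma> * A' * wt_mass)
        \<le> exp (- K * s y) * (gauss_const * (LINT w|lborel. exp (- ((1 + C' * D) * q w / 2))) - \<sigma> * A' * wt_mass)"
      by (intro mult_left_mono) auto
    have sy: "exp (- K * s x) \<le> exp (- K * s y) * exp (- (K * c * D))"
    proof -
      have "K * (s y + c * D) \<le> K * s x" using c(2)[OF y] K by (simp add: D_def)
      then show ?thesis by (simp add: exp_add[symmetric] algebra_simps)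
    qed
    have sy1: "exp (- K * s y) \<le> exp (K * S) * exp (- K * s x)"
    proof -
      have "K * s x \<le> K * S" "0 \<le> K * s y" using S K s_nonneg by auto
      then show ?thesis unfolding exp_add[symmetric] exp_le_cancel_iff by linarith
    qed
    have "\<kappa> * (1 - A * sqrt \<nu>) * sub K x = exp (- K * s x) * \<kappa> - exp (K * S) * exp (- K * s x) * (\<sigma> * A' * wt_mass)"
      using x \<kappa>_pos by (simp add: sub_def A_def \<sigma>_def field_simps)
    also have "\<dots> \<le> exp (- K * s y) * exp (- (K * c * D)) * \<kappa> - exp (- K * s y) * (\<sigma> * A' * wt_mass)"
      using sy sy1 \<kappa>_pos \<sigma> A' wt_mass_pos by (intro diff_mono mult_right_mono) auto
    also have "\<dots> = exp (- K * s y) * (\<kappa> * exp (- (K * c * D)) - \<sigma> * A' * wt_mass)" by (simp add: algebra_simps)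
    also note main
    also have "exp (- K * s y) * (gauss_const * (LINT w|lborel. exp (- ((1 + C' * D) * q w / 2))) - \<sigma> * A' * wt_mass)
        = gauss_const * (LINT w|lborel. exp (- K * s y) * (exp (- ((1 + C' * D) * q w / 2)) - \<sigma> * A' * wt w))"
      using wt_integrable q_exp_integrable[OF D1] by (simp add: wt_mass_def algebra_simps)
    also have "\<dots> \<le> L \<nu> (sub K) x"
      unfolding L_energy(1)[OF \<nu> bS, of x y]
      using gauss_const_pos L_energy(2)[OF \<nu> bS, of x y] int pointwise
      by (intro mult_left_mono integral_mono) (auto simp: \<sigma>_def)
    finally show ?thesis .
  qed
  moreover have "A > 0" using A' wt_mass_pos \<kappa>_pos by (simp add: A_def)
  ultimately show ?thesis using that K by blast
qed

text \<open>This holds for every \<open>x\<close>, also off \<open>U\<close>: calibrated points lie in \<open>U\<close> together with a ball of uniform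
  radius, on which \<open>energy\<close> has a bound independent of \<open>\<nu>\<close>.\<close>

lemma L_sub_lower_bound:
  assumes "K > 0"
  obtains c where "c > 0" "\<And>\<nu> x. 0 < \<nu> \<Longrightarrow> \<nu> \<le> 1 \<Longrightarrow> L \<nu> (sub K) x \<ge> c"
proof -
  obtain S where S: "S > 0" "\<And>x. s x \<le> S" using s_bounded by blast
  obtain r where r: "r > 0" "\<And>x y. calibrated y x \<Longrightarrow> ball y r \<subseteq> U" using calibrated_ball_in_U by blast
  obtain C where C: "C > 0" "\<And>x y z. calibrated y x \<Longrightarrow> ht z x \<le> C * (norm (z - y))\<^sup>2"
    using ht_upper_quadratic by blast
  define b where "b = exp (- (C * r\<^sup>2 / 2)) * exp (- K * S)"
  define B where "B = ball (0 :: real ^ 'd) r"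
  define c where "c = gauss_const * (b * measure lborel B)"
  have "c \<le> L \<nu> (sub K) x" if \<nu>: "0 < \<nu>" "\<nu> \<le> 1" for \<nu> x
  proof -
    obtain y where y: "calibrated y x" using calibrated_exists by blast
    have bS: "bounded_measurable (sub K)" using assms by (intro bounded_measurable_sub) auto
    have pw: "b * indicator B w \<le> exp (- energy \<nu> x y w) * sub K (y + sqrt \<nu> *\<^sub>R w)" for w
    proof (cases "w \<in> B")
      case True
      then have w: "norm w < r" by (simp add: B_def)
      have "sqrt \<nu> * norm w \<le> 1 * norm w" using \<nu> by (intro mult_right_mono) auto
      then have "y + sqrt \<nu> *\<^sub>R w \<in> ball y r" using w \<nu> by (simp add: dist_norm)
      then have U: "y + sqrt \<nu> *\<^sub>R w \<in> U" using r(2)[OF y] by blast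
      have "ht (y + sqrt \<nu> *\<^sub>R w) x \<le> C * (\<nu> * (norm w)\<^sup>2)"
        using C(2)[OF y, of "y + sqrt \<nu> *\<^sub>R w"] \<nu> by (simp add: power_mult_distrib)
      also have "\<dots> \<le> C * (\<nu> * r\<^sup>2)" using C w \<nu> by (intro mult_left_mono power_mono) auto
      finally have "energy \<nu> x y w \<le> C * r\<^sup>2 / 2" using \<nu> by (simp add: energy_def field_simps)
      then have "exp (- (C * r\<^sup>2 / 2)) \<le> exp (- energy \<nu> x y w)" by simp
      moreover have "exp (- K * S) \<le> sub K (y + sqrt \<nu> *\<^sub>R w)"
        using U S assms by (simp add: sub_def)
      ultimately show ?thesis using True by (simp add: b_def mult_mono)
    next
      case False
      then show ?thesis by (simp add: sub_nonneg)
    qed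
    have "(LINT w|lborel. b * indicator B w) \<le> (LINT w|lborel. exp (- energy \<nu> x y w) * sub K (y + sqrt \<nu> *\<^sub>R w))"
    proof (rule integral_mono)
      show "integrable lborel (\<lambda>w. b * indicator B w)"
        using emeasure_bounded_finite[of B]
        by (intro integrable_mult_right integrable_real_indicator) (auto simp: B_def)
    qed (use pw L_energy(2)[OF \<nu>(1) bS] in auto)
    then have "gauss_const * (b * measure lborel B) \<le> gauss_const * (LINT w|lborel. exp (- energy \<nu> x y w) * sub K (y + sqrt \<nu> *\<^sub>R w))"
      using gauss_const_pos by (intro mult_left_mono) auto
    then show ?thesis unfolding c_def L_energy(1)[OF \<nu>(1) bS, of x y] .
  qed
  moreover have "c > 0" using gauss_const_pos content_ball_pos[OF r(1)]
    by (simp add: c_def b_def B_def)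
  ultimately show ?thesis using that by blast
qed

end

section \<open>Two-sided bounds for the iterates\<close>

theorem proposition4p3:
  fixes F \<psi> :: "real ^ 'd::finite \<Rightarrow> real" and U :: "(real ^ 'd) set" and \<delta> :: real
  assumes "admissible_potential F"
    and "weak_kam_solution F \<psi>"
    and "\<delta> > 0"
    and "admissible_nbhd F \<psi> \<delta> U"
  shows "\<exists>(C::real) (\<nu>\<^sub>0::real) (Q :: nat \<Rightarrow> real).
    C > 1 \<and> \<nu>\<^sub>0 > 0 \<and> (\<forall>n. Q n > 0) \<and>
    (\<forall>n. inverse C \<le> Q (Suc n) / Q n \<and> Q (Suc n) / Q n \<le> C) \<and>
    (\<forall>\<nu> n x. 0 < \<nu> \<and> \<nu> \<le> \<nu>\<^sub>0 \<and>
       real n \<le> inverse C * (\<nu> * ln (1 / \<nu>)) powr (- 1 / 3) \<longrightarrow>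
       inverse C \<le> (L_tilde F \<psi> \<nu> ^^ n) (\<lambda>_. 1) x / Q n \<and>
       (L_tilde F \<psi> \<nu> ^^ n) (\<lambda>_. 1) x / Q n \<le> C * chi_nu U \<nu> x)"
proof -
  interpret weak_kam_nbhd F \<psi> \<delta> U by unfold_locales (rule assms)+
  obtain S where S: "S > 0" "\<And>x. s x \<le> S" using s_bounded by blast
  obtain K M A where K: "K > 0" and M: "M \<ge> 1" and A: "A \<ge> 0"
    and super: "\<And>\<nu> x. 0 < \<nu> \<Longrightarrow> \<nu> \<le> 1 \<Longrightarrow> L \<nu> (super K M \<nu>) x \<le> \<kappa> * (1 + A * sqrt \<nu>) * super K M \<nu> x"
    using supersolution by blast
  obtain K' A' where K': "K' > 0" and A': "A' > 0"
    and sub: "\<And>\<nu> x. 0 < \<nu> \<Longrightarrow> L \<nu> (sub K') x \<ge> \<kappa> * (1 - A' * sqrt \<nu>) * sub K' x"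
    using subsolution by blast
  obtain c where c: "c > 0" "\<And>\<nu> x. 0 < \<nu> \<Longrightarrow> \<nu> \<le> 1 \<Longrightarrow> L \<nu> (sub K') x \<ge> c"
    using L_sub_lower_bound[OF K'] by blast
  define R where "R = max (exp (K * S)) M * exp A"
  define C where "C = 2 + \<kappa> + 1 / \<kappa> + R + 2 * \<kappa> / c"
  \<comment> \<open>The second bound makes \<open>A' * n * sqrt \<nu> \<le> 1 / 2\<close>, so that Bernoulli's inequality keeps the accumulated factor at least \<open>1 / 2\<close>.\<close>
  define \<nu>\<^sub>0 where "\<nu>\<^sub>0 = min (exp (- 1)) ((1 / (2 * A')) powr 6)"
  have "R \<ge> 0" using M by (simp add: R_def le_max_iff_disj)
  moreover have "1 / \<kappa> > 0" "2 * \<kappa> / c > 0" using \<kappa>_pos c by auto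
  ultimately have C: "C > 1" "C \<ge> 1" "\<kappa> \<le> C" "1 / \<kappa> \<le> C" "R \<le> C" "2 * \<kappa> / c \<le> C"
    unfolding C_def using \<kappa>_pos by linarith+
  have \<nu>\<^sub>0: "\<nu>\<^sub>0 > 0" using A' by (simp add: \<nu>\<^sub>0_def)
  have "inverse C \<le> (L \<nu> ^^ n) (\<lambda>_. 1) x / \<kappa> ^ n \<and> (L \<nu> ^^ n) (\<lambda>_. 1) x / \<kappa> ^ n \<le> C * chi_nu U \<nu> x"
    if \<nu>: "0 < \<nu>" "\<nu> \<le> \<nu>\<^sub>0" and n: "real n \<le> inverse C * (\<nu> * ln (1 / \<nu>)) powr (- 1 / 3)" for \<nu> n x
  proof
    have e: "\<nu> \<le> exp (- 1)" using \<nu> by (simp add: \<nu>\<^sub>0_def)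
    also have "exp (- 1) \<le> (1::real)" by simp
    finally have \<nu>1: "\<nu> \<le> 1" .
    have count: "real n * sqrt \<nu> \<le> \<nu> powr (1 / 6)" by (rule iteration_count_bound[OF \<nu>(1) e C(2) n])
    have chi: "chi_nu U \<nu> x \<ge> 0" by (simp add: chi_nu_def)
    have large: "\<nu> powr (- (real CARD('d) / 2)) \<ge> 1"
      using \<nu>(1) \<nu>1 powr_mono2'[of "- (real CARD('d) / 2)" \<nu> 1] by simp
    have "(L \<nu> ^^ n) (\<lambda>_. 1) x \<le> (\<kappa> * (1 + A * sqrt \<nu>)) ^ n * super K M \<nu> x"
    proof (rule supersolution_iterate[OF \<nu>(1)])
      show "1 \<le> super K M \<nu> x" for x
        using K M large s_nonneg[of x] mult_mono[of 1 M 1 "\<nu> powr (- (real CARD('d) / 2))"]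
        by (simp add: super_def)
    qed (use K M A \<kappa>_pos \<nu> \<nu>1 super bounded_measurable_super in auto)
    also have "\<dots> = \<kappa> ^ n * ((1 + A * sqrt \<nu>) ^ n * super K M \<nu> x)" by (simp add: power_mult_distrib)
    also have "\<dots> \<le> \<kappa> ^ n * (exp A * (max (exp (K * S)) M * chi_nu U \<nu> x))"
    proof (intro mult_left_mono mult_mono)
      have "(1 + A * sqrt \<nu>) ^ n \<le> exp (A * sqrt \<nu>) ^ n"
        using A \<nu> by (intro power_mono exp_ge_add_one_self) auto
      also have "\<dots> = exp (A * (real n * sqrt \<nu>))" by (simp add: exp_of_nat_mult[symmetric] mult_ac)
      also have "\<dots> \<le> exp (A * 1)"
      proof -
        have "real n * sqrt \<nu> \<le> 1" using count powr_le1[of "1/6" \<nu>] \<nu> \<nu>1 by simp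
        then show ?thesis using A by (simp only: exp_le_cancel_iff mult_left_mono)
      qed
      finally show "(1 + A * sqrt \<nu>) ^ n \<le> exp A" by simp
      have "exp (K * s x) \<le> exp (K * S)" using S K by simp
      then show "super K M \<nu> x \<le> max (exp (K * S)) M * chi_nu U \<nu> x"
        by (auto simp: super_def chi_nu_def le_max_iff_disj intro!: mult_right_mono)
      show "0 \<le> super K M \<nu> x" using M by (simp add: super_def)
    qed (use \<kappa>_pos in auto)
    also have "\<dots> = \<kappa> ^ n * (R * chi_nu U \<nu> x)" by (simp add: R_def)
    also have "\<dots> \<le> \<kappa> ^ n * (C * chi_nu U \<nu> x)"
      using C chi \<kappa>_pos by (intro mult_left_mono mult_right_mono) auto
    finally show "(L \<nu> ^^ n) (\<lambda>_. 1) x / \<kappa> ^ n \<le> C * chi_nu U \<nu> x"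
      using \<kappa>_pos by (simp add: pos_divide_le_eq mult.commute)
    show "inverse C \<le> (L \<nu> ^^ n) (\<lambda>_. 1) x / \<kappa> ^ n"
    proof (cases n)
      case 0
      then show ?thesis using C by (simp add: inverse_le_1_iff)
    next
      case (Suc m)
      have "\<nu> powr (1 / 6) \<le> ((1 / (2 * A')) powr 6) powr (1 / 6)"
        using \<nu> by (intro powr_mono2) (auto simp: \<nu>\<^sub>0_def)
      also have "\<dots> = 1 / (2 * A')" using A' by (simp only: powr_powr) simp
      finally have small: "\<nu> powr (1 / 6) \<le> 1 / (2 * A')" .
      define t where "t = A' * sqrt \<nu>"
      have "real m * sqrt \<nu> \<le> real n * sqrt \<nu>" "1 * sqrt \<nu> \<le> real n * sqrt \<nu>"
        using Suc \<nu> by (auto intro!: mult_right_mono)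
      then have "real m * sqrt \<nu> \<le> 1 / (2 * A')" "sqrt \<nu> \<le> 1 / (2 * A')"
        using count small by linarith+
      then have t: "real m * t \<le> 1 / 2" "t \<le> 1 / 2" "t \<ge> 0"
        using A' \<nu> by (auto simp: t_def field_simps)
      have "c / 2 * \<kappa> ^ m \<le> (\<kappa> * (1 - t)) ^ m * c"
      proof -
        have "1 / 2 \<le> (1 - t) ^ m" using Bernoulli_inequality[of "- t" m] t by simp
        then have "\<kappa> ^ m * c * (1 / 2) \<le> \<kappa> ^ m * c * (1 - t) ^ m"
          using \<kappa>_pos c by (intro mult_left_mono) auto
        then show ?thesis by (simp add: power_mult_distrib mult_ac)
      qed
      also have "\<dots> \<le> (\<kappa> * (1 - t)) ^ m * L \<nu> (sub K') x"
        using c(2)[OF \<nu>(1) \<nu>1] \<kappa>_pos t by (intro mult_left_mono) auto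
      also have "\<dots> = L \<nu> (\<lambda>x. (\<kappa> * (1 - t)) ^ m * sub K' x) x" by (rule L_scale[symmetric])
      also have "\<dots> \<le> L \<nu> ((L \<nu> ^^ m) (\<lambda>_. 1)) x"
      proof (rule L_mono[OF \<nu>(1)])
        show "(\<kappa> * (1 - t)) ^ m * sub K' x \<le> (L \<nu> ^^ m) (\<lambda>_. 1) x" for x
          by (rule subsolution_iterate[OF \<nu>(1)])
            (use K' \<kappa>_pos t sub[OF \<nu>(1)] in \<open>auto simp: t_def intro: bounded_measurable_sub sub_le_1\<close>)
      qed (use K' \<kappa>_pos t \<nu> in \<open>auto intro!: bounded_measurable_mult bounded_measurable_sub bounded_measurable_L_iterate\<close>)
      also have "\<dots> = (L \<nu> ^^ n) (\<lambda>_. 1) x" using Suc by simp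
      finally have low: "c / 2 * \<kappa> ^ m \<le> (L \<nu> ^^ n) (\<lambda>_. 1) x" .
      have "inverse C \<le> inverse (2 * \<kappa> / c)"
        using C \<kappa>_pos c by (intro le_imp_inverse_le) auto
      also have "\<dots> = c / 2 * \<kappa> ^ m / \<kappa> ^ n" using \<kappa>_pos Suc by (simp add: field_simps)
      also have "\<dots> \<le> (L \<nu> ^^ n) (\<lambda>_. 1) x / \<kappa> ^ n"
        using low \<kappa>_pos by (intro divide_right_mono) auto
      finally show ?thesis .
    qed
  qed
  moreover have "inverse C \<le> \<kappa> ^ Suc n / \<kappa> ^ n \<and> \<kappa> ^ Suc n / \<kappa> ^ n \<le> C" for n
  proof -
    have "inverse C \<le> inverse (1 / \<kappa>)" using C \<kappa>_pos by (intro le_imp_inverse_le) auto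
    then show ?thesis using C \<kappa>_pos by simp
  qed
  ultimately show ?thesis
    using C(1) \<nu>\<^sub>0 \<kappa>_pos by (intro exI[of _ C] exI[of _ \<nu>\<^sub>0] exI[of _ "\<lambda>n. \<kappa> ^ n"]) auto
qed

end
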